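(* Let $n\ge1$, $\sigma>0$ and $k\ge0$. Then the map $u\mapsto\tau_{\cdot,u}(\sigma)$ extends to a bounded linear operator $L^2(\mathbb{R}^n)\to H^k(\mathbb{R}^n)$. Moreover, there exists a constant $C_k(\sigma)>0$ such that $$\|\tau_{\cdot,u}(\sigma)\|_{H^k}\le C_k(\sigma)\,\|u\|_{L^2}\qquad\text{for every }u\in L^2(\mathbb{R}^n).$$
   Context: $\gamma_\sigma(x)=(2\pi\sigma^2)^{-n/2}\exp(-|x|^2/(2\sigma^2))$ is the Gaussian kernel on $\mathbb{R}^n$. For a function $u$ on $\mathbb{R}^n$, $z\in\mathbb{R}^n$ and $\sigma>0$, the pointwise multiscale texture operator is $\tau_{z,u}(\sigma)=\frac{\partial}{\partial\sigma}(u*\gamma_\sigma)(z)$; equivalently $\tau_{z,u}(\sigma)=(u*\Phi_\sigma)(z)$ with $\Phi_\sigma=\partial_\sigma\gamma_\sigma=\sigma\Delta\gamma_\sigma$. $H^k(\mathbb{R}^n)$ is the $L^2$-based Sobolev space with norm $\|f\|_{H^k}^2=\int_{\mathbb{R}^n}(1+|\xi|^2)^k|\hat f(\xi)|^2\,d\xi$ (up to a normalization constant). *)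

theory Defs
  imports "HOL-Analysis.Analysis"
begin

text \<open>
  Functions on \<open>real ^ 'n\<close> are complex valued; real-valued functions are the special case
  of functions with values in \<open>\<real>\<close>. Elements of \<open>L\<^sup>2\<close> and \<open>H\<^sup>k\<close> are represented by functions
  rather than by classes modulo a.e. equality, so the "norms" below are norms on the classes.
\<close>

definition gaussian :: "real \<Rightarrow> real ^ 'n \<Rightarrow> real" where
  "gaussian \<sigma> x =
     (2 * pi * \<sigma>\<^sup>2) powr (- real CARD('n) / 2) * exp (- (norm x)\<^sup>2 / (2 * \<sigma>\<^sup>2))"

definition convolution :: "(real ^ 'n \<Rightarrow> complex) \<Rightarrow> (real ^ 'n \<Rightarrow> real) \<Rightarrow> real ^ 'n \<Rightarrow> complex" where
  "convolution u \<phi> z = (LINT y|lebesgue. \<phi> (z - y) *\<^sub>R u y)"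

definition texture :: "real ^ 'n \<Rightarrow> (real ^ 'n \<Rightarrow> complex) \<Rightarrow> real \<Rightarrow> complex" where
  "texture z u \<sigma> = vector_derivative (\<lambda>s. convolution u (gaussian s) z) (at \<sigma>)"

definition L2_space :: "(real ^ 'n \<Rightarrow> complex) set" where
  "L2_space = {u \<in> borel_measurable lebesgue. integrable lebesgue (\<lambda>x. (norm (u x))\<^sup>2)}"

definition L2_norm :: "(real ^ 'n \<Rightarrow> complex) \<Rightarrow> real" where
  "L2_norm u = sqrt (LINT x|lebesgue. (norm (u x))\<^sup>2)"

definition fourier_L1 :: "(real ^ 'n \<Rightarrow> complex) \<Rightarrow> real ^ 'n \<Rightarrow> complex" where
  "fourier_L1 f \<xi> = (LINT x|lebesgue. cis (- (\<xi> \<bullet> x)) * f x)"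

text \<open>
  The Fourier(-Plancherel) transform of \<open>f \<in> L\<^sup>2\<close> is the \<open>L\<^sup>2\<close> limit of the Fourier integrals of the
  truncations of \<open>f\<close> to balls, which are in \<open>L\<^sup>1\<close>; it is determined up to a.e. equality. The limit
  is stated with the nonnegative integral because the Bochner integral of a non-integrable function
  would be \<open>0\<close>.
\<close>

definition has_fourier_L2 :: "(real ^ 'n \<Rightarrow> complex) \<Rightarrow> (real ^ 'n \<Rightarrow> complex) \<Rightarrow> bool" where
  "has_fourier_L2 f g \<longleftrightarrow>
     g \<in> L2_space \<and>
     ((\<lambda>R::real. \<integral>\<^sup>+ \<xi>. ennreal
         ((norm (g \<xi> - fourier_L1 (\<lambda>x. indicator (cball 0 R) x *\<^sub>R f x) \<xi>))\<^sup>2) \<partial>lebesgue)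
       \<longlongrightarrow> 0) at_top"

definition fourier_L2 :: "(real ^ 'n \<Rightarrow> complex) \<Rightarrow> real ^ 'n \<Rightarrow> complex" where
  "fourier_L2 f = (SOME g. has_fourier_L2 f g)"

text \<open>The order \<open>k\<close> may be any real number \<open>\<ge> 0\<close>.\<close>

definition sobolev_space :: "real \<Rightarrow> (real ^ 'n \<Rightarrow> complex) set" where
  "sobolev_space k = {f \<in> L2_space.
     integrable lebesgue (\<lambda>\<xi>. (1 + (norm \<xi>)\<^sup>2) powr k * (norm (fourier_L2 f \<xi>))\<^sup>2)}"

definition sobolev_norm :: "real \<Rightarrow> (real ^ 'n \<Rightarrow> complex) \<Rightarrow> real" where
  "sobolev_norm k f =
     sqrt (LINT \<xi>|lebesgue. (1 + (norm \<xi>)\<^sup>2) powr k * (norm (fourier_L2 f \<xi>))\<^sup>2)"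

text \<open>
  \<open>T\<close> induces a bounded linear operator between the spaces of a.e. classes of functions in \<open>V\<close>
  and in \<open>W\<close>: the first condition says that it respects a.e. equality, and linearity is an identity
  between classes.
\<close>

definition bounded_linear_operator ::
  "(real ^ 'n \<Rightarrow> complex) set \<Rightarrow> ((real ^ 'n \<Rightarrow> complex) \<Rightarrow> real) \<Rightarrow>
   (real ^ 'n \<Rightarrow> complex) set \<Rightarrow> ((real ^ 'n \<Rightarrow> complex) \<Rightarrow> real) \<Rightarrow>
   ((real ^ 'n \<Rightarrow> complex) \<Rightarrow> (real ^ 'n \<Rightarrow> complex)) \<Rightarrow> bool" where
  "bounded_linear_operator V norm_V W norm_W T \<longleftrightarrow>
     (\<forall>u\<in>V. \<forall>v\<in>V. (AE x in lebesgue. u x = v x) \<longrightarrow> (AE x in lebesgue. T u x = T v x)) \<and>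
     (\<forall>u\<in>V. T u \<in> W) \<and>
     (\<forall>u\<in>V. \<forall>v\<in>V. AE x in lebesgue. T (\<lambda>y. u y + v y) x = T u x + T v x) \<and>
     (\<forall>c. \<forall>u\<in>V. AE x in lebesgue. T (\<lambda>y. c * u y) x = c * T u x) \<and>
     (\<exists>C. \<forall>u\<in>V. norm_W (T u) \<le> C * norm_V u)"

end

theory Submission
  imports "HOL-Probability.Characteristic_Functions" Defs
begin

text \<open>
  Differentiating under the integral sign gives \<open>\<tau> = u * \<Phi>\<close> with \<open>\<Phi> = \<partial>\<^sub>\<sigma> \<gamma>\<^sub>\<sigma>\<close>, and, applied to a character
  instead of \<open>u\<close>, it turns the transform \<open>exp (- \<sigma>\<^sup>2 |\<xi>|\<^sup>2 / 2)\<close> of the Gaussian into that of \<open>\<Phi>\<close>, namely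
  \<open>m(\<xi>) = - \<sigma> |\<xi>|\<^sup>2 exp (- \<sigma>\<^sup>2 |\<xi>|\<^sup>2 / 2)\<close>. The transform of \<open>\<tau>\<close> is \<open>m\<close> times that of \<open>u\<close>, and \<open>(1 + |\<xi>|\<^sup>2)\<^sup>k |m(\<xi>)|\<^sup>2\<close>
  is bounded. All that is needed from the \<open>L\<^sup>2\<close> theory of the Fourier transform is Plancherel's
  inequality on \<open>L\<^sup>1 \<inter> L\<^sup>2\<close>: for \<open>w\<^sub>s(\<xi>) = exp (- s\<^sup>2 |\<xi>|\<^sup>2 / 2)\<close> two uses of the multiplication formula
  \<open>\<integral> F f \<cdot> g = \<integral> f \<cdot> F g\<close> give \<open>\<integral> w\<^sub>s |F v|\<^sup>2 = (2\<pi>)\<^sup>n \<langle>v, v * \<gamma>\<^sub>s\<rangle> \<le> (2\<pi>)\<^sup>n \<parallel>v\<parallel>\<^sup>2\<close>, and \<open>s\<close> tends to \<open>0\<close>.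
\<close>

section \<open>The Gaussian and its Fourier transform\<close>

text \<open>\<open>has_fourier_L2\<close> fixes the transform of a function by truncating that very
  function, and truncation does not commute with convolution: a cut-off of \<open>u * \<Phi>\<close>
  is in general not the convolution of a cut-off of \<open>u\<close>. The multiplier identity
  therefore works with two radii, one for \<open>u\<close> and one for the convolution, sent to
  infinity one after the other. \<open>fourier_L2\<close> picks one of many a.e. equal transforms,
  so every claim about it rests on existence together with uniqueness up to null sets. Fubini and
  Tonelli are applied on products of \<open>lborel\<close>, so the analysis is carried out for Borel
  functions; a Lebesgue measurable \<open>u\<close> is replaced by an a.e. equal Borel function,
  which leaves its convolutions and Fourier integrals unchanged at every point.\<close>

lemma distr_lborel_reflect: "distr lborel borel (\<lambda>y. z - y) = (lborel :: 'a::euclidean_space measure)"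
  by (subst lborel_affine[of "-1" z]) (auto simp: density_1 one_ennreal_def[symmetric])

lemma nn_integral_lborel_reflect:
  fixes f :: "'a::euclidean_space \<Rightarrow> ennreal"
  assumes "f \<in> borel_measurable borel"
  shows "(\<integral>\<^sup>+y. f (z - y) \<partial>lborel) = (\<integral>\<^sup>+y. f y \<partial>lborel)"
  by (subst (2) distr_lborel_reflect[of z, symmetric]) (use assms in \<open>simp add: nn_integral_distr\<close>)

lemma nn_integral_lborel_translate:
  fixes f :: "'a::euclidean_space \<Rightarrow> ennreal"
  assumes "f \<in> borel_measurable borel"
  shows "(\<integral>\<^sup>+z. f (z - y) \<partial>lborel) = (\<integral>\<^sup>+y. f y \<partial>lborel)"
  by (subst (2) lborel_distr_plus[of "-y", symmetric]) (use assms in \<open>simp add: nn_integral_distr\<close>)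

lemma integral_lborel_translate:
  fixes f :: "'a::euclidean_space \<Rightarrow> 'b::{banach, second_countable_topology}"
  assumes "f \<in> borel_measurable borel"
  shows "(LINT z|lborel. f (z - y)) = (LINT y|lborel. f y)"
  by (subst (2) lborel_distr_plus[of "-y", symmetric]) (use assms in \<open>simp add: integral_distr\<close>)

lemma integrable_lborel_reflect:
  fixes f :: "'a::euclidean_space \<Rightarrow> 'b::{banach, second_countable_topology}"
  assumes f: "integrable lborel f"
  shows "integrable lborel (\<lambda>y. f (z - y))"
proof -
  have [measurable]: "f \<in> borel_measurable borel"
    using borel_measurable_integrable[OF f] by simp
  have "integrable (distr lborel borel (\<lambda>y. z - y)) f"
    using f by (simp add: distr_lborel_reflect)
  then show ?thesis
    by (subst (asm) integrable_distr_eq) auto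
qed

text \<open>\<open>lborel\<close> on a Euclidean space is the image of the product of
  one-dimensional Lebesgue measures under the coordinate map, so functions that factor over the
  coordinates integrate factor by factor. This reduces the Gaussian transform to dimension
  one.\<close>

lemma integral_lborel_prod:
  fixes f :: "'a::euclidean_space \<Rightarrow> real \<Rightarrow> complex"
  assumes int: "\<And>b. b \<in> Basis \<Longrightarrow> integrable lborel (f b)"
  shows "integrable lborel (\<lambda>x. \<Prod>b\<in>Basis. f b (x \<bullet> b))"
    and "(LINT x|lborel. (\<Prod>b\<in>Basis. f b (x \<bullet> b))) = (\<Prod>b\<in>Basis. LINT t|lborel. f b t)"
proof -
  interpret product_sigma_finite "\<lambda>_::'a. lborel :: real measure" ..
  have [measurable]: "f b \<in> borel_measurable borel" if "b \<in> Basis" for b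
    using borel_measurable_integrable[OF int[OF that]] by simp
  have m: "(\<lambda>x. \<Prod>b\<in>Basis. f b (x \<bullet> b)) \<in> borel_measurable (borel :: 'a measure)"
    by measurable
  have m': "(\<lambda>f. \<Sum>b\<in>Basis. f b *\<^sub>R b) \<in> (\<Pi>\<^sub>M b\<in>(Basis::'a set). lborel) \<rightarrow>\<^sub>M borel"
    by measurable
  have eq: "(\<Prod>b\<in>Basis. f b ((\<Sum>c\<in>Basis. g c *\<^sub>R c) \<bullet> b)) = (\<Prod>b\<in>Basis. f b (g b))" for g
    by (intro prod.cong refl) (simp add: inner_sum_left inner_Basis if_distrib cong: if_cong)
  show "integrable lborel (\<lambda>x. \<Prod>b\<in>Basis. f b (x \<bullet> b))"
    unfolding lborel_eq[where 'a='a]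
    by (subst integrable_distr_eq[OF m' m]) (simp add: eq product_integrable_prod int)
  show "(LINT x|lborel. (\<Prod>b\<in>Basis. f b (x \<bullet> b))) = (\<Prod>b\<in>Basis. LINT t|lborel. f b t)"
    unfolding lborel_eq[where 'a='a]
    by (subst integral_distr[OF m' m]) (simp add: eq product_integral_prod int)
qed

text \<open>Rescaling the variable by \<open>s\<close> reduces the integral to the characteristic
  function of the standard normal distribution at \<open>- t * s\<close>.\<close>

lemma cis_normal_density:
  assumes s: "s > 0"
  shows "integrable lborel (\<lambda>x. cis (- (t * x)) * of_real (normal_density 0 s x))"
    and "(LINT x|lborel. cis (- (t * x)) * of_real (normal_density 0 s x))
         = of_real (exp (- (s\<^sup>2 * t\<^sup>2) / 2))"
proof -
  have "integrable lborel (\<lambda>x. normal_density 0 s x)"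
    using s by simp
  then show "integrable lborel (\<lambda>x. cis (- (t * x)) * of_real (normal_density 0 s x))"
    by (rule Bochner_Integration.integrable_bound) (auto simp: norm_mult cis_conv_exp)
  have "(LINT x|lborel. cis (- (t * x)) * of_real (normal_density 0 s x))
      = s *\<^sub>R (LINT x|lborel. cis (- (t * (s * x))) * of_real (normal_density 0 s (s * x)))"
    using lborel_integral_real_affine[of s "\<lambda>x. cis (- (t * x)) * of_real (normal_density 0 s x)" 0] s
    by simp
  also have "\<dots> = (LINT x|lborel. std_normal_density x *\<^sub>R exp (\<i> * complex_of_real ((- t * s) * x)))"
  proof -
    have "s *\<^sub>R (cis (- (t * (s * x))) * of_real (normal_density 0 s (s * x)))
        = std_normal_density x *\<^sub>R exp (\<i> * complex_of_real ((- t * s) * x))" for x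
    proof -
      have "s * normal_density 0 s (s * x) = std_normal_density x"
        using s by (simp add: normal_density_def real_sqrt_mult power_mult_distrib)
      then have "complex_of_real s * of_real (normal_density 0 s (s * x)) = of_real (std_normal_density x)"
        by (metis of_real_mult)
      then show ?thesis
        by (simp add: cis_conv_exp scaleR_conv_of_real mult_ac)
    qed
    then show ?thesis
      by (subst integral_scaleR_right[symmetric]) simp
  qed
  also have "\<dots> = char std_normal_distribution (- t * s)"
    unfolding char_def by (subst integral_density) (auto intro!: measurable_completion borel_measurable_continuous_onI continuous_intros)
  also have "\<dots> = of_real (exp (- (s\<^sup>2 * t\<^sup>2) / 2))"
    by (simp add: char_std_normal_distribution power_mult_distrib mult.commute)
  finally show "(LINT x|lborel. cis (- (t * x)) * of_real (normal_density 0 s x))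
         = of_real (exp (- (s\<^sup>2 * t\<^sup>2) / 2))" .
qed

lemma norm_squared_eq_sum: "(norm x)\<^sup>2 = (\<Sum>b\<in>Basis. (x \<bullet> b)\<^sup>2)" for x :: "'a::euclidean_space"
  unfolding power2_norm_eq_inner by (subst euclidean_inner) (simp add: power2_eq_square)

lemma gaussian_eq_prod:
  fixes x :: "real ^ 'n"
  assumes s: "s > 0"
  shows "gaussian s x = (\<Prod>b\<in>Basis. normal_density 0 s (x \<bullet> b))"
proof -
  have "(2 * pi * s\<^sup>2) powr (- real CARD('n) / 2) = (1 / sqrt (2 * pi * s\<^sup>2)) ^ CARD('n)"
  proof -
    have "(2 * pi * s\<^sup>2) powr (- real CARD('n) / 2) = ((2 * pi * s\<^sup>2) powr (-(1/2))) powr real CARD('n)"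
      by (simp only: powr_powr) simp
    also have "\<dots> = (1 / sqrt (2 * pi * s\<^sup>2)) powr real CARD('n)"
      using s by (simp only: powr_minus powr_half_sqrt) (simp add: powr_half_sqrt field_simps)
    finally show ?thesis
      using s by (simp add: powr_realpow)
  qed
  moreover have "exp (- (norm x)\<^sup>2 / (2 * s\<^sup>2)) = (\<Prod>b\<in>Basis. exp (- (x \<bullet> b)\<^sup>2 / (2 * s\<^sup>2)))"
    by (simp add: norm_squared_eq_sum exp_sum[symmetric] sum_negf sum_divide_distrib)
  ultimately show ?thesis
    by (simp add: gaussian_def normal_density_def prod.distrib prod_dividef power_one_over)
qed

lemma
  fixes \<xi> :: "real ^ 'n"
  assumes s: "s > 0"
  shows integrable_cis_gaussian: "integrable lborel (\<lambda>x. cis (- (\<xi> \<bullet> x)) * of_real (gaussian s x))"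
    and integral_cis_gaussian: "(LINT x|lborel. cis (- (\<xi> \<bullet> x)) * of_real (gaussian s x))
         = of_real (exp (- (s\<^sup>2 * (norm \<xi>)\<^sup>2) / 2))"
proof -
  have cis_sum: "cis (\<Sum>b\<in>A. h b) = (\<Prod>b\<in>A. cis (h b))" if "finite A" for h and A :: "'z set"
    using that by (induction rule: finite_induct) (auto simp: cis_mult[symmetric])
  have eq: "cis (- (\<xi> \<bullet> x)) * of_real (gaussian s x) =
     (\<Prod>b\<in>Basis. cis (- ((\<xi> \<bullet> b) * (x \<bullet> b))) * of_real (normal_density 0 s (x \<bullet> b)))" for x
    by (subst euclidean_inner) (simp add: gaussian_eq_prod s prod.distrib cis_sum sum_negf[symmetric])
  show "integrable lborel (\<lambda>x. cis (- (\<xi> \<bullet> x)) * of_real (gaussian s x))"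
    unfolding eq by (intro integral_lborel_prod(1) cis_normal_density s)
  show "(LINT x|lborel. cis (- (\<xi> \<bullet> x)) * of_real (gaussian s x))
         = of_real (exp (- (s\<^sup>2 * (norm \<xi>)\<^sup>2) / 2))"
    unfolding eq by (subst integral_lborel_prod(2)) (auto intro: cis_normal_density s
      simp: cis_normal_density s exp_sum[symmetric] norm_squared_eq_sum sum_divide_distrib sum_negf sum_distrib_left
        simp flip: of_real_prod)
qed

lemma gaussian_nonneg [simp]: "0 \<le> gaussian s x"
  by (simp add: gaussian_def)

lemma continuous_gaussian: "continuous_on UNIV (gaussian s)"
  unfolding gaussian_def divide_inverse by (intro continuous_intros)

lemma borel_measurable_gaussian [measurable]: "gaussian s \<in> borel_measurable borel"
  by (rule borel_measurable_continuous_onI[OF continuous_gaussian])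

lemma
  assumes s: "s > 0"
  shows integrable_gaussian: "integrable lborel (gaussian s :: real ^ 'n \<Rightarrow> real)"
    and integral_gaussian: "(LINT x|lborel. gaussian s (x :: real ^ 'n)) = 1"
proof -
  have "integrable lborel (\<lambda>x :: real ^ 'n. complex_of_real (gaussian s x))"
    using integrable_cis_gaussian[OF s, of "0 :: real ^ 'n"] by simp
  then show "integrable lborel (gaussian s :: real ^ 'n \<Rightarrow> real)"
    using integrable_Re by fastforce
  have "(LINT x|lborel. complex_of_real (gaussian s (x :: real ^ 'n))) = 1"
    using integral_cis_gaussian[OF s, of "0 :: real ^ 'n"] by simp
  then show "(LINT x|lborel. gaussian s (x :: real ^ 'n)) = 1"
    by (metis integral_complex_of_real of_real_eq_1_iff)
qed

lemma nn_integral_gaussian: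
  assumes s: "s > 0"
  shows "(\<integral>\<^sup>+x. ennreal (gaussian s (x :: real ^ 'n)) \<partial>lborel) = 1"
  by (subst nn_integral_eq_integral[OF integrable_gaussian[OF s]]) (simp_all add: integral_gaussian s)

section \<open>The squared \<open>L\<^sup>2\<close> norm\<close>

text \<open>
  Working with squares keeps all estimates in \<^typ>\<open>ennreal\<close>, free of square roots; the price is the
  factor 2 in the triangle inequality.
\<close>

definition L2sq :: "'a measure \<Rightarrow> ('a \<Rightarrow> complex) \<Rightarrow> ennreal" where
  "L2sq M f = (\<integral>\<^sup>+x. ennreal ((norm (f x))\<^sup>2) \<partial>M)"

lemma norm_add_squared_le: "(norm (a + b))\<^sup>2 \<le> 2 * (norm a)\<^sup>2 + 2 * (norm b)\<^sup>2"
  for a b :: "'a::real_normed_vector"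
proof -
  have "(norm (a + b))\<^sup>2 \<le> (norm a + norm b)\<^sup>2"
    by (intro power_mono norm_triangle_ineq) simp
  also have "\<dots> \<le> 2 * (norm a)\<^sup>2 + 2 * (norm b)\<^sup>2"
    using sum_squares_bound[of "norm a" "norm b"] by (simp add: power2_sum)
  finally show ?thesis .
qed

lemma L2sq_add:
  assumes [measurable]: "f \<in> borel_measurable M" "g \<in> borel_measurable M"
  shows "L2sq M (\<lambda>x. f x + g x) \<le> 2 * L2sq M f + 2 * L2sq M g"
proof -
  have "ennreal ((norm (f x + g x))\<^sup>2) \<le> 2 * ennreal ((norm (f x))\<^sup>2) + 2 * ennreal ((norm (g x))\<^sup>2)" for x
  proof -
    have "ennreal ((norm (f x + g x))\<^sup>2) \<le> ennreal (2 * (norm (f x))\<^sup>2 + 2 * (norm (g x))\<^sup>2)"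
      by (intro ennreal_leI norm_add_squared_le)
    then show ?thesis
      by (simp add: ennreal_mult')
  qed
  then have "L2sq M (\<lambda>x. f x + g x)
      \<le> (\<integral>\<^sup>+x. 2 * ennreal ((norm (f x))\<^sup>2) + 2 * ennreal ((norm (g x))\<^sup>2) \<partial>M)"
    unfolding L2sq_def by (intro nn_integral_mono)
  also have "\<dots> = 2 * L2sq M f + 2 * L2sq M g"
    by (simp add: L2sq_def nn_integral_add nn_integral_cmult)
  finally show ?thesis .
qed

lemma L2sq_diff_commute: "L2sq M (\<lambda>x. f x - g x) = L2sq M (\<lambda>x. g x - f x)"
  by (simp add: L2sq_def norm_minus_commute)

lemma L2sq_triangle:
  assumes [measurable]: "f \<in> borel_measurable M" "g \<in> borel_measurable M" "h \<in> borel_measurable M"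
  shows "L2sq M (\<lambda>x. f x - h x) \<le> 2 * L2sq M (\<lambda>x. f x - g x) + 2 * L2sq M (\<lambda>x. g x - h x)"
  using L2sq_add[of "\<lambda>x. f x - g x" M "\<lambda>x. g x - h x"] by simp

lemma L2sq_cong_AE: "AE x in M. f x = g x \<Longrightarrow> L2sq M f = L2sq M g"
  unfolding L2sq_def by (rule nn_integral_cong_AE) auto

lemma L2sq_mult_le:
  assumes [measurable]: "f \<in> borel_measurable M" and h: "\<And>x. norm (h x) \<le> C"
  shows "L2sq M (\<lambda>x. h x * f x) \<le> ennreal (C\<^sup>2) * L2sq M f"
proof -
  have "ennreal ((norm (h x * f x))\<^sup>2) \<le> ennreal (C\<^sup>2) * ennreal ((norm (f x))\<^sup>2)" for x
    unfolding norm_mult power_mult_distrib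
    by (subst ennreal_mult[symmetric]) (auto intro!: ennreal_leI mult_right_mono power_mono h)
  then have "L2sq M (\<lambda>x. h x * f x) \<le> (\<integral>\<^sup>+x. ennreal (C\<^sup>2) * ennreal ((norm (f x))\<^sup>2) \<partial>M)"
    unfolding L2sq_def by (intro nn_integral_mono)
  then show ?thesis
    by (simp add: L2sq_def nn_integral_cmult)
qed

text \<open>Fatou's lemma for squares; it carries bounds on the \<open>F j\<close> over to their
  a.e. limit.\<close>

lemma L2sq_le_liminf:
  assumes [measurable]: "\<And>j. F j \<in> borel_measurable M" "g \<in> borel_measurable M"
    and lim: "AE x in M. (\<lambda>j. F j x) \<longlonglongrightarrow> g x"
  shows "L2sq M g \<le> liminf (\<lambda>j. L2sq M (F j))"
proof -
  have "L2sq M g = (\<integral>\<^sup>+x. liminf (\<lambda>j. ennreal ((norm (F j x))\<^sup>2)) \<partial>M)"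
    unfolding L2sq_def
  proof (rule nn_integral_cong_AE)
    show "AE x in M. ennreal ((norm (g x))\<^sup>2) = liminf (\<lambda>j. ennreal ((norm (F j x))\<^sup>2))"
      using lim
    proof eventually_elim
      case (elim x)
      then have "(\<lambda>j. ennreal ((norm (F j x))\<^sup>2)) \<longlonglongrightarrow> ennreal ((norm (g x))\<^sup>2)"
        by (intro tendsto_intros)
      from lim_imp_Liminf[OF _ this] show ?case
        by simp
    qed
  qed
  also have "\<dots> \<le> liminf (\<lambda>j. L2sq M (F j))"
    unfolding L2sq_def by (rule nn_integral_liminf) measurable
  finally show ?thesis .
qed

text \<open>The core of the completeness of L2 (Riesz-Fischer). Weighting the squared increments by
  \<open>2^j\<close> still leaves summable integrals, at most \<open>(1/2)^j\<close>, so the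
  weighted series is finite a.e.; at such points the increments themselves are absolutely
  summable.\<close>

lemma convergent_if_L2sq_increments:
  assumes [measurable]: "\<And>j. F j \<in> borel_measurable M"
    and F: "\<And>j. L2sq M (\<lambda>x. F (Suc j) x - F j x) \<le> ennreal ((1/4)^j)"
  obtains g where "g \<in> borel_measurable M" "AE x in M. (\<lambda>j. F j x) \<longlonglongrightarrow> g x"
proof
  define d where "d j x = F (Suc j) x - F j x" for j x
  have [measurable]: "d j \<in> borel_measurable M" for j
    unfolding d_def by measurable
  have "(\<integral>\<^sup>+x. (\<Sum>j. ennreal (2^j * (norm (d j x))\<^sup>2)) \<partial>M)
      = (\<Sum>j. (\<integral>\<^sup>+x. ennreal (2^j * (norm (d j x))\<^sup>2) \<partial>M))"
    by (rule nn_integral_suminf) measurable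
  also have "\<dots> \<le> (\<Sum>j. ennreal ((1/2)^j))"
  proof (intro suminf_le summableI)
    fix j
    have "(\<integral>\<^sup>+x. ennreal (2^j * (norm (d j x))\<^sup>2) \<partial>M) = ennreal (2^j) * L2sq M (d j)"
      unfolding L2sq_def by (simp add: ennreal_mult nn_integral_cmult)
    also have "\<dots> \<le> ennreal (2^j) * ennreal ((1/4)^j)"
      using F[of j] unfolding d_def by (intro mult_left_mono) auto
    also have "\<dots> = ennreal ((1/2)^j)"
      by (simp add: ennreal_mult[symmetric] power_mult_distrib[symmetric])
    finally show "(\<integral>\<^sup>+x. ennreal (2^j * (norm (d j x))\<^sup>2) \<partial>M) \<le> ennreal ((1/2)^j)" .
  qed
  also have "\<dots> < \<infinity>"
    by (subst suminf_ennreal2) (auto intro: summable_geometric)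
  finally have "(\<integral>\<^sup>+x. (\<Sum>j. ennreal (2^j * (norm (d j x))\<^sup>2)) \<partial>M) \<noteq> \<infinity>"
    by simp
  then have fin: "AE x in M. (\<Sum>j. ennreal (2^j * (norm (d j x))\<^sup>2)) \<noteq> \<infinity>"
    by (intro nn_integral_noteq_infinite) measurable
  show "AE x in M. (\<lambda>j. F j x) \<longlonglongrightarrow> lim (\<lambda>j. F j x)"
    using fin
  proof eventually_elim
    case (elim x)
    then have "summable (\<lambda>j. 2^j * (norm (d j x))\<^sup>2)"
      by (intro summable_suminf_not_top) auto
    then have sum: "summable (\<lambda>j. (1/2)^j + 2^j * (norm (d j x))\<^sup>2)"
      by (intro summable_add) (auto intro: summable_geometric)
    have "summable (\<lambda>j. d j x)"
    proof (rule summable_comparison_test'[OF sum])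
      fix j
      \<comment> \<open>Either the increment is below \<open>(1/2)^j\<close>, or
        \<open>2^j * norm (d j x)\<close> is at least 1, and multiplying by
        \<open>norm (d j x)\<close> bounds it by the second term. No square root of the series is
        taken.\<close>
      show "norm (d j x) \<le> (1/2)^j + 2^j * (norm (d j x))\<^sup>2"
      proof (cases "norm (d j x) \<le> (1/2)^j")
        case False
        then have "1 \<le> 2^j * norm (d j x)"
          by (simp add: field_simps power_one_over)
        then have "norm (d j x) * 1 \<le> norm (d j x) * (2^j * norm (d j x))"
          by (intro mult_left_mono) auto
        then have "norm (d j x) \<le> 2^j * (norm (d j x))\<^sup>2"
          by (simp add: power2_eq_square mult_ac)
        then show ?thesis
          by (simp add: add_increasing)
      qed (simp add: add_increasing2)
    qed
    then have "convergent (\<lambda>n. F n x - F 0 x)"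
      unfolding summable_iff_convergent d_def by (simp add: sum_lessThan_telescope[of "\<lambda>j. F j x"])
    then have "convergent (\<lambda>n. (F n x - F 0 x) + F 0 x)"
      by (intro convergent_add convergent_const)
    then have "convergent (\<lambda>n. F n x)"
      by simp
    then show ?case
      by (simp add: convergent_LIMSEQ_iff)
  qed
  show "(\<lambda>x. lim (\<lambda>j. F j x)) \<in> borel_measurable M"
    by measurable
qed

section \<open>Young's inequality for convolutions\<close>

lemma convolution_lborel:
  assumes [measurable]: "u \<in> borel_measurable borel" "\<phi> \<in> borel_measurable borel"
  shows "convolution u \<phi> z = (LINT y|lborel. \<phi> (z - y) *\<^sub>R u y)"
  unfolding convolution_def by (rule integral_completion) measurable

text \<open>Splitting \<open>\<bar>\<phi>\<bar>\<close> into two square roots, Cauchy-Schwarz bounds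
  the squared convolution at \<open>z\<close> by \<open>A\<close> times the integral of
  \<open>\<bar>\<phi> (z - y)\<bar> * (norm (u y))\<^sup>2\<close>; integrating over
  \<open>z\<close> with Tonelli yields the second factor \<open>A\<close>.\<close>

lemma L2sq_convolution_le:
  fixes \<phi> :: "real ^ 'n \<Rightarrow> real" and u :: "real ^ 'n \<Rightarrow> complex"
  assumes [measurable]: "\<phi> \<in> borel_measurable borel" "u \<in> borel_measurable borel"
  shows "L2sq lborel (convolution u \<phi>) \<le> (\<integral>\<^sup>+y. ennreal \<bar>\<phi> y\<bar> \<partial>lborel)\<^sup>2 * L2sq lborel u"
proof -
  define A where "A = (\<integral>\<^sup>+y. ennreal \<bar>\<phi> y\<bar> \<partial>lborel)"
  have "ennreal ((norm (LINT y|lborel. \<phi> (z - y) *\<^sub>R u y))\<^sup>2)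
      \<le> A * (\<integral>\<^sup>+y. ennreal \<bar>\<phi> (z - y)\<bar> * ennreal ((norm (u y))\<^sup>2) \<partial>lborel)" for z
  proof -
    have "ennreal ((norm (LINT y|lborel. \<phi> (z - y) *\<^sub>R u y))\<^sup>2)
       = (ennreal (norm (LINT y|lborel. \<phi> (z - y) *\<^sub>R u y)))\<^sup>2"
      by (simp add: ennreal_power)
    also have "\<dots> \<le> (\<integral>\<^sup>+y. ennreal (norm (\<phi> (z - y) *\<^sub>R u y)) \<partial>lborel)\<^sup>2"
    proof (cases "integrable lborel (\<lambda>y. \<phi> (z - y) *\<^sub>R u y)")
      case True
      then show ?thesis
        by (intro power_mono integral_norm_bound_ennreal) auto
    \<comment> \<open>Where the integrand is not integrable, the Bochner integral is 0 and the bound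
      is trivial.\<close>
    qed (simp add: not_integrable_integral_eq)
    also have "(\<lambda>y. ennreal (norm (\<phi> (z - y) *\<^sub>R u y)))
        = (\<lambda>y. ennreal (sqrt \<bar>\<phi> (z - y)\<bar>) * ennreal (sqrt \<bar>\<phi> (z - y)\<bar> * norm (u y)))"
      by (simp add: ennreal_mult[symmetric] mult.assoc[symmetric])
    also have "(\<integral>\<^sup>+y. ennreal (sqrt \<bar>\<phi> (z - y)\<bar>) * ennreal (sqrt \<bar>\<phi> (z - y)\<bar> * norm (u y)) \<partial>lborel)\<^sup>2
        \<le> (\<integral>\<^sup>+y. (ennreal (sqrt \<bar>\<phi> (z - y)\<bar>))\<^sup>2 \<partial>lborel)
          * (\<integral>\<^sup>+y. (ennreal (sqrt \<bar>\<phi> (z - y)\<bar> * norm (u y)))\<^sup>2 \<partial>lborel)"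
      by (rule Cauchy_Schwarz_nn_integral) measurable
    also have "(\<integral>\<^sup>+y. (ennreal (sqrt \<bar>\<phi> (z - y)\<bar>))\<^sup>2 \<partial>lborel) = A"
      unfolding A_def by (subst nn_integral_lborel_reflect[of _ z, symmetric]) (simp_all add: ennreal_power)
    also have "(\<integral>\<^sup>+y. (ennreal (sqrt \<bar>\<phi> (z - y)\<bar> * norm (u y)))\<^sup>2 \<partial>lborel)
        = (\<integral>\<^sup>+y. ennreal \<bar>\<phi> (z - y)\<bar> * ennreal ((norm (u y))\<^sup>2) \<partial>lborel)"
      by (simp add: ennreal_power ennreal_mult[symmetric] power_mult_distrib)
    finally show ?thesis .
  qed
  then have "L2sq lborel (\<lambda>z. LINT y|lborel. \<phi> (z - y) *\<^sub>R u y)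
     \<le> (\<integral>\<^sup>+z. A * (\<integral>\<^sup>+y. ennreal \<bar>\<phi> (z - y)\<bar> * ennreal ((norm (u y))\<^sup>2) \<partial>lborel) \<partial>lborel)"
    unfolding L2sq_def by (intro nn_integral_mono)
  also have "\<dots> = A * (\<integral>\<^sup>+z. \<integral>\<^sup>+y. ennreal \<bar>\<phi> (z - y)\<bar> * ennreal ((norm (u y))\<^sup>2) \<partial>lborel \<partial>lborel)"
    by (rule nn_integral_cmult) measurable
  also have "(\<integral>\<^sup>+z. \<integral>\<^sup>+y. ennreal \<bar>\<phi> (z - y)\<bar> * ennreal ((norm (u y))\<^sup>2) \<partial>lborel \<partial>lborel)
     = (\<integral>\<^sup>+y. \<integral>\<^sup>+z. ennreal \<bar>\<phi> (z - y)\<bar> * ennreal ((norm (u y))\<^sup>2) \<partial>lborel \<partial>lborel)"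
    by (rule lborel_pair.Fubini'[symmetric]) measurable
  also have "\<dots> = (\<integral>\<^sup>+y. A * ennreal ((norm (u y))\<^sup>2) \<partial>lborel)"
    by (subst nn_integral_multc) (auto simp: A_def nn_integral_lborel_translate[of "\<lambda>y. ennreal \<bar>\<phi> y\<bar>"])
  also have "\<dots> = A * L2sq lborel u"
    unfolding L2sq_def by (rule nn_integral_cmult) measurable
  finally show ?thesis
    by (simp add: A_def power2_eq_square mult.assoc L2sq_def convolution_lborel)
qed

section \<open>The Fourier transform of integrable functions\<close>

lemma borel_measurable_cis_inner [measurable (raw)]:
  fixes f g :: "'b \<Rightarrow> real ^ 'n"
  assumes [measurable]: "f \<in> borel_measurable M" "g \<in> borel_measurable M"
  shows "(\<lambda>x. cis (f x \<bullet> g x)) \<in> borel_measurable M"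
    and "(\<lambda>x. cis (- (f x \<bullet> g x))) \<in> borel_measurable M"
proof -
  have [measurable]: "cis \<in> borel_measurable borel"
    by (intro borel_measurable_continuous_onI continuous_intros)
  show "(\<lambda>x. cis (f x \<bullet> g x)) \<in> borel_measurable M"
    and "(\<lambda>x. cis (- (f x \<bullet> g x))) \<in> borel_measurable M"
    by measurable
qed

lemma fourier_L1_lborel:
  assumes [measurable]: "f \<in> borel_measurable borel"
  shows "fourier_L1 f \<xi> = (LINT x|lborel. cis (- (\<xi> \<bullet> x)) * f x)"
  unfolding fourier_L1_def by (rule integral_completion) measurable

lemma borel_measurable_fourier_L1:
  assumes [measurable]: "f \<in> borel_measurable borel"
  shows "fourier_L1 f \<in> borel_measurable borel"
  unfolding fourier_L1_lborel[OF assms] by measurable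

lemma borel_measurable_convolution:
  assumes [measurable]: "u \<in> borel_measurable borel" "\<phi> \<in> borel_measurable borel"
  shows "convolution u \<phi> \<in> borel_measurable borel"
  unfolding convolution_lborel[OF assms] by measurable

lemma norm_fourier_L1_le:
  shows "norm (fourier_L1 f \<xi>) \<le> (LINT x|lebesgue. norm (f x))"
  unfolding fourier_L1_def
  by (rule order_trans[OF integral_norm_bound]) (simp add: norm_mult)

lemma borel_measurable_integrable_lborel:
  fixes f :: "'a::euclidean_space \<Rightarrow> 'b::{banach, second_countable_topology}"
  shows "integrable lborel f \<Longrightarrow> f \<in> borel_measurable borel"
  using borel_measurable_integrable[of lborel f] by simp

lemma integrable_mult_bounded:
  fixes f h :: "'a \<Rightarrow> complex"
  assumes f: "integrable M f" and [measurable]: "h \<in> borel_measurable M"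
    and h: "\<And>x. norm (h x) \<le> C"
  shows "integrable M (\<lambda>x. h x * f x)"
proof (rule Bochner_Integration.integrable_bound)
  show "integrable M (\<lambda>x. of_real C * f x)"
    using f by simp
  show "(\<lambda>x. h x * f x) \<in> borel_measurable M"
    using f by measurable
  show "AE x in M. norm (h x * f x) \<le> norm (of_real C * f x)"
    using h by (auto simp: norm_mult intro!: mult_right_mono order_trans[OF h])
qed

text \<open>Fubini: the kernel \<open>cis (- (\<xi> \<bullet> x))\<close> is symmetric in its two
  arguments and has modulus 1, so the double integrand has modulus
  \<open>norm (f x) * norm (g \<xi>)\<close>.\<close>

lemma fourier_L1_multiplication_formula:
  fixes f g :: "real ^ 'n \<Rightarrow> complex"
  assumes f: "integrable lborel f" and g: "integrable lborel g"
  shows "(LINT \<xi>|lborel. fourier_L1 f \<xi> * g \<xi>) = (LINT x|lborel. f x * fourier_L1 g x)"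
proof -
  have [measurable]: "f \<in> borel_measurable borel" "g \<in> borel_measurable borel"
    using f g by (auto intro: borel_measurable_integrable_lborel)
  define H where "H \<xi> x = cis (- (\<xi> \<bullet> x)) * (f x * g \<xi>)" for \<xi> x
  have "integrable (lborel \<Otimes>\<^sub>M lborel) (case_prod H)"
  proof (rule lborel_pair.Fubini_integrable)
    show "case_prod H \<in> borel_measurable (lborel \<Otimes>\<^sub>M lborel)"
      unfolding H_def by measurable
    show "integrable lborel (\<lambda>\<xi>. LINT x|lborel. norm (case (\<xi>, x) of (\<xi>, x) \<Rightarrow> H \<xi> x))"
      using f g by (simp add: H_def norm_mult)
    show "AE \<xi> in lborel. integrable lborel (\<lambda>x. case (\<xi>, x) of (\<xi>, x) \<Rightarrow> H \<xi> x)"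
      unfolding H_def split using f
      by (intro AE_I2 integrable_mult_bounded[where C=1] integrable_mult_left) auto
  qed
  from lborel_pair.Fubini_integral[OF this]
  have "(LINT x|lborel. LINT \<xi>|lborel. H \<xi> x) = (LINT \<xi>|lborel. LINT x|lborel. H \<xi> x)" .
  moreover have "(LINT \<xi>|lborel. H \<xi> x) = f x * fourier_L1 g x" for x
    unfolding H_def fourier_L1_lborel[OF \<open>g \<in> borel_measurable borel\<close>]
    by (subst integral_mult_right_zero[symmetric]) (simp add: mult_ac inner_commute)
  moreover have "(LINT x|lborel. H \<xi> x) = fourier_L1 f \<xi> * g \<xi>" for \<xi>
    unfolding H_def fourier_L1_lborel[OF \<open>f \<in> borel_measurable borel\<close>]
    by (subst integral_mult_left_zero[symmetric]) (simp add: mult_ac)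
  ultimately show ?thesis
    by simp
qed

text \<open>The character at \<open>z\<close> is the product of those at \<open>z - y\<close> and at
  \<open>y\<close>. After Fubini, translation invariance turns the inner integral over
  \<open>z\<close> into the transform of \<open>\<phi>\<close> times a factor in
  \<open>y\<close>.\<close>

lemma
  fixes v :: "real ^ 'n \<Rightarrow> complex"
  assumes \<phi>: "integrable lborel \<phi>" and v: "integrable lborel v"
  shows integrable_convolution: "integrable lborel (convolution v \<phi>)"
    and fourier_L1_convolution:
      "fourier_L1 (convolution v \<phi>) \<xi> = fourier_L1 (\<lambda>x. of_real (\<phi> x)) \<xi> * fourier_L1 v \<xi>"
proof -
  have [measurable]: "\<phi> \<in> borel_measurable borel" "v \<in> borel_measurable borel"
    using \<phi> v by (auto intro: borel_measurable_integrable_lborel)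
  define H where "H \<xi> y z = cis (- (\<xi> \<bullet> z)) * (\<phi> (z - y) *\<^sub>R v y)" for \<xi> y z :: "real ^ 'n"
  have \<phi>_transl: "integrable lborel (\<lambda>z. \<phi> (z - y))" for y
    using integrable_lborel_reflect[OF integrable_lborel_reflect[OF \<phi>, of 0], of y] by simp
  have H: "integrable (lborel \<Otimes>\<^sub>M lborel) (case_prod (H \<xi>))" for \<xi>
  proof (rule lborel_pair.Fubini_integrable)
    show "case_prod (H \<xi>) \<in> borel_measurable (lborel \<Otimes>\<^sub>M lborel)"
      unfolding H_def by measurable
    have "(LINT z|lborel. norm (H \<xi> y z)) = (LINT x|lborel. \<bar>\<phi> x\<bar>) * norm (v y)" for y
      unfolding H_def norm_mult by (simp add: integral_lborel_translate[of "\<lambda>x. \<bar>\<phi> x\<bar>"])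
    then show "integrable lborel (\<lambda>y. LINT z|lborel. norm (case (y, z) of (y, z) \<Rightarrow> H \<xi> y z))"
      using v by simp
    show "AE y in lborel. integrable lborel (\<lambda>z. case (y, z) of (y, z) \<Rightarrow> H \<xi> y z)"
      unfolding H_def split
      by (intro AE_I2 integrable_mult_bounded[where C=1] integrable_scaleR_left \<phi>_transl) auto
  qed
  have conv: "(LINT y|lborel. H \<xi> y z) = cis (- (\<xi> \<bullet> z)) * convolution v \<phi> z" for \<xi> z
    unfolding H_def by (subst integral_mult_right_zero) (simp add: convolution_lborel)
  \<comment> \<open>At frequency 0 the character is 1, so the inner integral of \<open>H 0\<close>
    is the convolution itself.\<close>
  show "integrable lborel (convolution v \<phi>)"
    using lborel_pair.integrable_snd[OF H[of 0]] by (simp add: conv)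
  have cis_eq: "cis (- (\<xi> \<bullet> z)) = cis (- (\<xi> \<bullet> (z - y))) * cis (- (\<xi> \<bullet> y))" for z y
    by (simp add: cis_mult inner_diff_right)
  have \<phi>_ft: "(LINT z|lborel. H \<xi> y z) = fourier_L1 (\<lambda>x. of_real (\<phi> x)) \<xi> * (cis (- (\<xi> \<bullet> y)) * v y)" for y
  proof -
    have "(LINT z|lborel. H \<xi> y z)
        = (LINT z|lborel. cis (- (\<xi> \<bullet> (z - y))) * of_real (\<phi> (z - y))) * (cis (- (\<xi> \<bullet> y)) * v y)"
      unfolding H_def integral_mult_left_zero[symmetric]
      by (intro Bochner_Integration.integral_cong refl, subst cis_eq[of _ y])
         (simp only: scaleR_conv_of_real mult_ac)
    also have "(LINT z|lborel. cis (- (\<xi> \<bullet> (z - y))) * of_real (\<phi> (z - y)))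
        = (LINT z|lborel. cis (- (\<xi> \<bullet> z)) * of_real (\<phi> z))"
      by (rule integral_lborel_translate) measurable
    finally show ?thesis
      by (simp add: fourier_L1_lborel)
  qed
  have "fourier_L1 (convolution v \<phi>) \<xi> = (LINT z|lborel. LINT y|lborel. H \<xi> y z)"
    by (simp add: conv fourier_L1_lborel borel_measurable_convolution)
  also have "\<dots> = (LINT y|lborel. LINT z|lborel. H \<xi> y z)"
    by (rule lborel_pair.Fubini_integral[OF H])
  also have "\<dots> = fourier_L1 (\<lambda>x. of_real (\<phi> x)) \<xi> * fourier_L1 v \<xi>"
    by (simp add: \<phi>_ft fourier_L1_lborel)
  finally show "fourier_L1 (convolution v \<phi>) \<xi> = fourier_L1 (\<lambda>x. of_real (\<phi> x)) \<xi> * fourier_L1 v \<xi>" .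
qed

text \<open>The weight is a multiple of the Gaussian of reciprocal width \<open>1 / s\<close>, whose
  transform is in turn a multiple of the Gaussian of width \<open>s\<close>. Here \<open>c a\<close>
  is the reciprocal of the normalising factor at width \<open>a\<close>, and
  \<open>c (1 / s) * c s\<close> is where the power of \<open>2 * pi\<close> comes from.\<close>

lemma
  assumes s: "s > 0"
  shows integrable_exp_norm_squared:
      "integrable lborel (\<lambda>\<xi> :: real ^ 'n. complex_of_real (exp (- (s\<^sup>2 * (norm \<xi>)\<^sup>2) / 2)))"
    and fourier_L1_exp_norm_squared:
      "fourier_L1 (\<lambda>\<xi> :: real ^ 'n. complex_of_real (exp (- (s\<^sup>2 * (norm \<xi>)\<^sup>2) / 2))) x
        = of_real ((2 * pi) ^ CARD('n) * gaussian s x)"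
proof -
  define c where "c a = (2 * pi * a\<^sup>2) powr (real CARD('n) / 2)" for a
  have w: "exp (- (s\<^sup>2 * (norm \<xi>)\<^sup>2) / 2) = c (1 / s) * gaussian (1 / s) \<xi>" for \<xi> :: "real ^ 'n"
    using s by (simp add: gaussian_def c_def powr_minus field_simps)
  have g: "exp (- (norm x)\<^sup>2 / (2 * s\<^sup>2)) = c s * gaussian s x"
    using s by (simp add: gaussian_def c_def powr_minus field_simps)
  have cc: "c (1 / s) * c s = (2 * pi) ^ CARD('n)"
  proof -
    have "c (1 / s) * c s = ((2 * pi)\<^sup>2) powr (real CARD('n) / 2)"
      unfolding c_def using s by (subst powr_mult[symmetric]) (auto simp: power2_eq_square field_simps)
    also have "\<dots> = (2 * pi) powr real CARD('n)"
      by (subst powr_numeral[symmetric]) (simp_all only: powr_powr, simp_all)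
    finally show ?thesis
      by (simp add: powr_realpow)
  qed
  show "integrable lborel (\<lambda>\<xi> :: real ^ 'n. complex_of_real (exp (- (s\<^sup>2 * (norm \<xi>)\<^sup>2) / 2)))"
    unfolding w of_real_mult using s by (intro integrable_mult_right integrable_of_real integrable_gaussian) simp
  have "fourier_L1 (\<lambda>\<xi> :: real ^ 'n. complex_of_real (exp (- (s\<^sup>2 * (norm \<xi>)\<^sup>2) / 2))) x
      = of_real (c (1 / s)) * (LINT \<xi>|lborel. cis (- (x \<bullet> \<xi>)) * of_real (gaussian (1 / s) \<xi>))"
    unfolding w integral_mult_right_zero[symmetric]
    by (subst fourier_L1_lborel) (simp_all add: mult.left_commute del: integral_mult_right_zero)
  also have "\<dots> = of_real (c (1 / s) * exp (- (norm x)\<^sup>2 / (2 * s\<^sup>2)))"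
    using s by (subst integral_cis_gaussian) (auto simp: power_divide field_simps)
  also have "\<dots> = of_real ((2 * pi) ^ CARD('n) * gaussian s x)"
    unfolding g by (simp only: cc[symmetric] mult.assoc)
  finally show "fourier_L1 (\<lambda>\<xi> :: real ^ 'n. complex_of_real (exp (- (s\<^sup>2 * (norm \<xi>)\<^sup>2) / 2))) x
        = of_real ((2 * pi) ^ CARD('n) * gaussian s x)" .
qed

text \<open>The weight makes \<open>(norm (V \<xi>))\<^sup>2\<close> integrable although
  \<open>V\<close> is so far only known to be bounded. Pairing \<open>v\<close> with a character
  times \<open>w\<close> in the multiplication formula computes the transform of
  \<open>cnj V * w\<close>; pairing \<open>v\<close> with \<open>cnj V * w\<close> then turns the
  weighted integral into an integral of \<open>v\<close> against \<open>cnj G\<close>.\<close>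

lemma nn_integral_fourier_L1_weighted_le:
  fixes v :: "real ^ 'n \<Rightarrow> complex"
  assumes v: "integrable lborel v" and s: "s > 0"
  shows "(\<integral>\<^sup>+\<xi>. ennreal (exp (- (s\<^sup>2 * (norm \<xi>)\<^sup>2) / 2) * (norm (fourier_L1 v \<xi>))\<^sup>2) \<partial>lborel)
      \<le> ennreal ((2 * pi) ^ CARD('n)) * L2sq lborel v"
proof -
  define w where "w \<xi> = complex_of_real (exp (- (s\<^sup>2 * (norm \<xi>)\<^sup>2) / 2))" for \<xi> :: "real ^ 'n"
  define V where "V = fourier_L1 v"
  define G where "G = convolution v (gaussian s)"
  have w: "integrable lborel w"
    unfolding w_def using s by (rule integrable_exp_norm_squared)
  have [measurable]: "v \<in> borel_measurable borel" "w \<in> borel_measurable borel"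
    using v w by (auto intro: borel_measurable_integrable_lborel)
  have [measurable]: "V \<in> borel_measurable borel" "G \<in> borel_measurable borel"
    by (auto simp: V_def G_def borel_measurable_fourier_L1 borel_measurable_convolution)
  have [measurable]: "cnj \<in> borel_measurable borel"
    by (intro borel_measurable_continuous_onI continuous_intros)
  obtain C where C: "\<And>\<xi>. norm (V \<xi>) \<le> C"
    using norm_fourier_L1_le[of v] unfolding V_def by blast
  have g: "integrable lborel (\<lambda>\<xi>. cnj (V \<xi>) * w \<xi>)"
    by (rule integrable_mult_bounded[OF w, where C = C]) (auto simp: C)
  have ft_g: "fourier_L1 (\<lambda>\<xi>. cnj (V \<xi>) * w \<xi>) x = of_real ((2 * pi) ^ CARD('n)) * cnj (G x)" for x
  proof -
    have cw: "integrable lborel (\<lambda>\<xi>. cis (x \<bullet> \<xi>) * w \<xi>)"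
      by (rule integrable_mult_bounded[OF w, where C = 1]) auto
    \<comment> \<open>Modulating \<open>w\<close> by a character translates its transform.\<close>
    have ft_cw: "fourier_L1 (\<lambda>\<xi>. cis (x \<bullet> \<xi>) * w \<xi>) y = of_real ((2 * pi) ^ CARD('n) * gaussian s (x - y))" for y
    proof -
      have "fourier_L1 (\<lambda>\<xi>. cis (x \<bullet> \<xi>) * w \<xi>) y = fourier_L1 w (y - x)"
        unfolding fourier_L1_def by (simp add: mult.assoc[symmetric] cis_mult inner_diff_left)
      also have "\<dots> = of_real ((2 * pi) ^ CARD('n) * gaussian s (y - x))"
        unfolding w_def using s by (rule fourier_L1_exp_norm_squared)
      finally show ?thesis
        by (simp add: gaussian_def norm_minus_commute)
    qed
    \<comment> \<open>Since \<open>w\<close> is real, conjugating the whole integrand moves the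
      conjugate off \<open>V\<close> and flips the sign in the character.\<close>
    have "fourier_L1 (\<lambda>\<xi>. cnj (V \<xi>) * w \<xi>) x = (LINT \<xi>|lborel. cnj (V \<xi> * (cis (x \<bullet> \<xi>) * w \<xi>)))"
      by (subst fourier_L1_lborel) (auto simp: w_def cis_cnj mult_ac simp del: Bochner_Integration.integral_cnj)
    also have "\<dots> = cnj (LINT \<xi>|lborel. V \<xi> * (cis (x \<bullet> \<xi>) * w \<xi>))"
      by (rule Bochner_Integration.integral_cnj)
    also have "\<dots> = cnj (LINT y|lborel. v y * of_real ((2 * pi) ^ CARD('n) * gaussian s (x - y)))"
      unfolding V_def by (subst fourier_L1_multiplication_formula[OF v cw]) (simp add: ft_cw)
    also have "(LINT y|lborel. v y * of_real ((2 * pi) ^ CARD('n) * gaussian s (x - y)))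
        = of_real ((2 * pi) ^ CARD('n)) * G x"
      unfolding G_def by (subst convolution_lborel)
         (auto simp: scaleR_conv_of_real mult_ac simp flip: integral_mult_right_zero)
    finally show ?thesis
      by simp
  qed
  have w_real: "w \<xi> = of_real (exp (- (s\<^sup>2 * (norm \<xi>)\<^sup>2) / 2))" for \<xi>
    by (simp add: w_def)
  have eq: "V \<xi> * (cnj (V \<xi>) * w \<xi>) = of_real (exp (- (s\<^sup>2 * (norm \<xi>)\<^sup>2) / 2) * (norm (V \<xi>))\<^sup>2)" for \<xi>
    by (simp add: w_real mult.assoc[symmetric] complex_norm_square[symmetric])
  have "integrable lborel (\<lambda>\<xi>. V \<xi> * (cnj (V \<xi>) * w \<xi>))"
    by (rule integrable_mult_bounded[OF g, where C = C]) (auto simp: C)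
  then have int: "integrable lborel (\<lambda>\<xi>. exp (- (s\<^sup>2 * (norm \<xi>)\<^sup>2) / 2) * (norm (V \<xi>))\<^sup>2)"
    unfolding eq using integrable_Re by fastforce
  have "(\<integral>\<^sup>+\<xi>. ennreal (exp (- (s\<^sup>2 * (norm \<xi>)\<^sup>2) / 2) * (norm (V \<xi>))\<^sup>2) \<partial>lborel)
     = ennreal (LINT \<xi>|lborel. exp (- (s\<^sup>2 * (norm \<xi>)\<^sup>2) / 2) * (norm (V \<xi>))\<^sup>2)"
    by (rule nn_integral_eq_integral[OF int]) simp
  also have "\<dots> \<le> ennreal (norm (LINT \<xi>|lborel. V \<xi> * (cnj (V \<xi>) * w \<xi>)))"
    unfolding eq integral_complex_of_real norm_of_real by (intro ennreal_leI) simp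
  also have "(LINT \<xi>|lborel. V \<xi> * (cnj (V \<xi>) * w \<xi>))
      = (LINT x|lborel. of_real ((2 * pi) ^ CARD('n)) * (v x * cnj (G x)))"
    unfolding V_def by (subst fourier_L1_multiplication_formula[OF v g[unfolded V_def]])
      (simp only: ft_g[unfolded V_def] mult.left_commute)
  also have "\<dots> = of_real ((2 * pi) ^ CARD('n)) * (LINT x|lborel. v x * cnj (G x))"
    by simp
  also have "ennreal (norm \<dots>) = ennreal ((2 * pi) ^ CARD('n)) * ennreal (norm (LINT x|lborel. v x * cnj (G x)))"
    by (simp add: norm_mult norm_power ennreal_mult)
  also have "\<dots> \<le> ennreal ((2 * pi) ^ CARD('n)) * L2sq lborel v"
  proof (intro mult_left_mono)
    have "ennreal (norm (LINT x|lborel. v x * cnj (G x))) \<le> (\<integral>\<^sup>+x. ennreal (norm (v x * cnj (G x))) \<partial>lborel)"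
      by (cases "integrable lborel (\<lambda>x. v x * cnj (G x))")
         (auto intro: integral_norm_bound_ennreal simp: not_integrable_integral_eq)
    also have "\<dots> \<le> (\<integral>\<^sup>+x. ennreal (1/2) * ennreal ((norm (v x))\<^sup>2) + ennreal (1/2) * ennreal ((norm (G x))\<^sup>2) \<partial>lborel)"
    proof (rule nn_integral_mono)
      fix x
      \<comment> \<open>AM-GM stands in for Cauchy-Schwarz: it loses nothing here, because
        convolution with a kernel of mass 1 does not increase \<open>L2sq\<close>, so each half
        contributes at most half of \<open>L2sq lborel v\<close>.\<close>
      have "norm (v x * cnj (G x)) \<le> 1/2 * (norm (v x))\<^sup>2 + 1/2 * (norm (G x))\<^sup>2"
        using sum_squares_bound[of "norm (v x)" "norm (G x)"] by (simp add: norm_mult)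
      from ennreal_leI[OF this]
      show "ennreal (norm (v x * cnj (G x)))
         \<le> ennreal (1/2) * ennreal ((norm (v x))\<^sup>2) + ennreal (1/2) * ennreal ((norm (G x))\<^sup>2)"
        by (simp only: ennreal_plus ennreal_mult zero_le_power2 mult_nonneg_nonneg zero_le_divide_1_iff zero_le_numeral)
    qed
    also have "\<dots> = ennreal (1/2) * L2sq lborel v + ennreal (1/2) * L2sq lborel G"
      by (simp add: L2sq_def nn_integral_add nn_integral_cmult)
    also have "L2sq lborel G \<le> L2sq lborel v"
      using L2sq_convolution_le[of "gaussian s" v]
      by (simp add: G_def nn_integral_gaussian s)
    also have "ennreal (1/2) * L2sq lborel v + ennreal (1/2) * L2sq lborel v = L2sq lborel v"
      by (subst distrib_right[symmetric], subst ennreal_plus[symmetric]) simp_all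
    finally show "ennreal (norm (LINT x|lborel. v x * cnj (G x))) \<le> L2sq lborel v"
      by (simp add: add_left_mono mult_left_mono)
  qed simp
  finally show ?thesis
    unfolding V_def .
qed

text \<open>The weights tend to 1 pointwise along \<open>s j\<close>, and the weighted bound does
  not depend on \<open>s\<close>, so Fatou's lemma passes to the limit. Square integrability of the
  transform is thus a result, not a premise, when \<open>v\<close> is square integrable.\<close>

lemma L2sq_fourier_L1_le:
  fixes v :: "real ^ 'n \<Rightarrow> complex"
  assumes v: "integrable lborel v"
  shows "L2sq lborel (fourier_L1 v) \<le> ennreal ((2 * pi) ^ CARD('n)) * L2sq lborel v"
proof -
  define s where "s j = 1 / real (Suc j)" for j
  have [measurable]: "fourier_L1 v \<in> borel_measurable borel"
    using v by (intro borel_measurable_fourier_L1 borel_measurable_integrable_lborel)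
  have "L2sq lborel (fourier_L1 v) = (\<integral>\<^sup>+\<xi>. liminf (\<lambda>j. ennreal (exp (- ((s j)\<^sup>2 * (norm \<xi>)\<^sup>2) / 2) * (norm (fourier_L1 v \<xi>))\<^sup>2)) \<partial>lborel)"
    unfolding L2sq_def
  proof (rule nn_integral_cong)
    fix \<xi> :: "real ^ 'n"
    have "s \<longlonglongrightarrow> 0"
      unfolding s_def using LIMSEQ_inverse_real_of_nat by (simp add: inverse_eq_divide)
    then have "(\<lambda>j. ennreal (exp (- ((s j)\<^sup>2 * (norm \<xi>)\<^sup>2) / 2) * (norm (fourier_L1 v \<xi>))\<^sup>2))
       \<longlonglongrightarrow> ennreal (exp (- (0\<^sup>2 * (norm \<xi>)\<^sup>2) / 2) * (norm (fourier_L1 v \<xi>))\<^sup>2)"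
      by (intro tendsto_intros) auto
    from lim_imp_Liminf[OF _ this]
    show "ennreal ((norm (fourier_L1 v \<xi>))\<^sup>2) = liminf (\<lambda>j. ennreal (exp (- ((s j)\<^sup>2 * (norm \<xi>)\<^sup>2) / 2) * (norm (fourier_L1 v \<xi>))\<^sup>2))"
      by simp
  qed
  also have "\<dots> \<le> liminf (\<lambda>j. \<integral>\<^sup>+\<xi>. ennreal (exp (- ((s j)\<^sup>2 * (norm \<xi>)\<^sup>2) / 2) * (norm (fourier_L1 v \<xi>))\<^sup>2) \<partial>lborel)"
    by (rule nn_integral_liminf) measurable
  also have "\<dots> \<le> liminf (\<lambda>j. ennreal ((2 * pi) ^ CARD('n)) * L2sq lborel v)"
    by (intro Liminf_mono always_eventually allI nn_integral_fourier_L1_weighted_le v) (simp add: s_def)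
  finally show ?thesis
    by (simp add: Liminf_const)
qed

section \<open>The derivative of the Gaussian with respect to the scale\<close>

text \<open>The kernel \<Phi> in closed form. For \<open>s > 0\<close> it is also \<open>s\<close>
  times the Laplacian of the Gaussian, the latter being \<open>gaussian s x * ((norm x)\<^sup>2 / s
  ^ 4 - real CARD('n) / s\<^sup>2)\<close>.\<close>

definition gaussian_deriv :: "real \<Rightarrow> real ^ 'n \<Rightarrow> real" where
  "gaussian_deriv s x = gaussian s x * ((norm x)\<^sup>2 / s ^ 3 - real CARD('n) / s)"

lemma borel_measurable_gaussian_deriv [measurable]: "gaussian_deriv s \<in> borel_measurable borel"
  unfolding gaussian_deriv_def by measurable

lemma has_real_derivative_gaussian:
  fixes x :: "real ^ 'n"
  assumes s: "s > 0"
  shows "((\<lambda>s. gaussian s x) has_real_derivative gaussian_deriv s x) (at s)"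
proof (rule has_field_derivative_transform_within_open)
  \<comment> \<open>As a single exponential the Gaussian is open to the derivative rules; agreement
    on the open half-line \<open>{0<..}\<close> is enough to transfer the derivative.\<close>
  have eq: "exp (- real CARD('n) / 2 * ln (2 * pi * t\<^sup>2) - (norm x)\<^sup>2 / (2 * t\<^sup>2)) = gaussian t x"
    if "t > 0" for t
    using that by (simp add: gaussian_def powr_def mult_exp_exp)
  show "((\<lambda>t. exp (- real CARD('n) / 2 * ln (2 * pi * t\<^sup>2) - (norm x)\<^sup>2 / (2 * t\<^sup>2)))
      has_real_derivative gaussian_deriv s x) (at s)"
    unfolding gaussian_deriv_def eq[OF s, symmetric]
    by (rule derivative_eq_intros refl | use s in \<open>simp add: power2_eq_square power3_eq_cube divide_simps\<close>)+
  show "s \<in> {0<..}" "open {0 :: real<..}"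
    using s by auto
  show "exp (- real CARD('n) / 2 * ln (2 * pi * t\<^sup>2) - (norm x)\<^sup>2 / (2 * t\<^sup>2)) = gaussian t x"
    if "t \<in> {0<..}" for t
    by (rule eq) (use that in simp)
qed

text \<open>Differentiation under the integral needs a majorant that does not depend on
  \<open>s\<close>. Half of the exponent in \<open>exp (- q / 2)\<close> absorbs the quadratic
  factor; the remaining \<open>exp (- q / 4)\<close> is below the exponential of width
  \<open>3 * \<sigma>\<close>, as \<open>4 * s\<^sup>2 < 16 * \<sigma>\<^sup>2 < 18 *
  \<sigma>\<^sup>2 = 2 * (3 * \<sigma>)\<^sup>2\<close>. The lower end \<open>\<sigma> / 2\<close>
  of the window controls the prefactors, which blow up as \<open>s\<close> tends to 0.\<close>

lemma gaussian_deriv_bound: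
  assumes \<sigma>: "\<sigma> > 0"
  obtains C where "\<And>s (x :: real ^ 'n). s \<in> {\<sigma>/2<..<2*\<sigma>} \<Longrightarrow> \<bar>gaussian_deriv s x\<bar> \<le> C * gaussian (3 * \<sigma>) x"
proof
  fix s and x :: "real ^ 'n"
  assume "s \<in> {\<sigma>/2<..<2*\<sigma>}"
  then have s: "\<sigma> / 2 < s" "s < 2 * \<sigma>" and s0: "s > 0"
    using \<sigma> by auto
  define N where "N = real CARD('n)"
  define q where "q = (norm x)\<^sup>2 / s\<^sup>2"
  define c where "c a = (2 * pi * a\<^sup>2) powr (- N / 2)" for a
  have c_pos: "c a > 0" if "a > 0" for a
    using that by (simp add: c_def)
  have q: "q \<ge> 0"
    by (simp add: q_def)
  have 1: "c s \<le> c (\<sigma> / 2)"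
    unfolding c_def N_def using s \<sigma> by (intro powr_mono2') (auto intro!: power_mono mult_left_mono)
  have 2: "1 / s \<le> 2 / \<sigma>"
    using s s0 \<sigma> by (simp add: field_simps)
  have 3: "exp (- q / 2) * (q + N) \<le> (4 + N) * exp (- q / 4)"
  proof -
    have "q + N \<le> (4 + N) * exp (q / 4)"
    proof -
      have "q + N \<le> (4 + N) * (1 + q / 4)"
        using q by (simp add: N_def algebra_simps)
      also have "\<dots> \<le> (4 + N) * exp (q / 4)"
        using exp_ge_add_one_self[of "q / 4"] by (intro mult_left_mono) (auto simp: N_def)
      finally show ?thesis .
    qed
    then have "exp (- q / 2) * (q + N) \<le> exp (- q / 2) * ((4 + N) * exp (q / 4))"
      by (intro mult_left_mono) auto
    also have "\<dots> = (4 + N) * (exp (- q / 2) * exp (q / 4))"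
      by simp
    also have "exp (- q / 2) * exp (q / 4) = exp (- q / 4)"
      by (simp add: exp_add[symmetric])
    finally show ?thesis .
  qed
  have 4: "exp (- q / 4) \<le> exp (- (norm x)\<^sup>2 / (2 * (3 * \<sigma>)\<^sup>2))"
  proof -
    have "4 * s\<^sup>2 \<le> 2 * (3 * \<sigma>)\<^sup>2"
    proof -
      have "s\<^sup>2 \<le> 4 * \<sigma>\<^sup>2"
        using power_mono[of s "2 * \<sigma>" 2] s s0 by (simp add: power_mult_distrib)
      moreover have "0 \<le> \<sigma>\<^sup>2"
        by simp
      ultimately have "4 * s\<^sup>2 \<le> 2 * (9 * \<sigma>\<^sup>2)"
        by linarith
      then show ?thesis
        by (simp add: power_mult_distrib)
    qed
    then have "(norm x)\<^sup>2 / (2 * (3 * \<sigma>)\<^sup>2) \<le> (norm x)\<^sup>2 / (4 * s\<^sup>2)"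
      using s0 \<sigma> by (intro divide_left_mono) auto
    then show ?thesis
      by (simp add: q_def mult.commute)
  qed
  have "c s * (1 / s) * (exp (- q / 2) * (q + N))
      \<le> c (\<sigma> / 2) * (2 / \<sigma>) * ((4 + N) * exp (- (norm x)\<^sup>2 / (2 * (3 * \<sigma>)\<^sup>2)))"
  proof (rule mult_mono)
    show "c s * (1 / s) \<le> c (\<sigma> / 2) * (2 / \<sigma>)"
      using 1 2 s0 \<sigma> c_pos[of "\<sigma> / 2"] by (intro mult_mono) auto
    have "(4 + N) * exp (- q / 4) \<le> (4 + N) * exp (- (norm x)\<^sup>2 / (2 * (3 * \<sigma>)\<^sup>2))"
      using 4 by (intro mult_left_mono) (auto simp: N_def)
    with 3 show "exp (- q / 2) * (q + N) \<le> (4 + N) * exp (- (norm x)\<^sup>2 / (2 * (3 * \<sigma>)\<^sup>2))"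
      by (rule order_trans)
    show "0 \<le> c (\<sigma> / 2) * (2 / \<sigma>)"
      using \<sigma> c_pos[of "\<sigma> / 2"] by simp
    show "0 \<le> exp (- q / 2) * (q + N)"
      using q by (simp add: N_def)
  qed
  moreover have "\<bar>gaussian_deriv s x\<bar> \<le> c s * (1 / s) * (exp (- q / 2) * (q + N))"
  proof -
    have "gaussian_deriv s x = c s * (1 / s) * exp (- q / 2) * (q - N)"
      using s0 by (simp add: gaussian_deriv_def gaussian_def c_def N_def q_def power2_eq_square power3_eq_cube field_simps)
    then have "\<bar>gaussian_deriv s x\<bar> = c s * (1 / s) * exp (- q / 2) * \<bar>q - N\<bar>"
      using s0 c_pos[OF s0] by (simp add: abs_mult)
    also have "\<dots> \<le> c s * (1 / s) * exp (- q / 2) * (q + N)"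
      using s0 c_pos[OF s0] q by (intro mult_left_mono) (auto simp: N_def)
    finally show ?thesis
      by (simp add: mult.assoc)
  qed
  \<comment> \<open>The constant divides by the normalising factor of
    \<open>gaussian (3 * \<sigma>)\<close>, because the estimate so far contains only its
    exponential.\<close>
  ultimately show "\<bar>gaussian_deriv s x\<bar> \<le>
      ((2 * pi * (\<sigma> / 2)\<^sup>2) powr (- real CARD('n) / 2) * (2 / \<sigma>) * (4 + real CARD('n)) / (2 * pi * (3 * \<sigma>)\<^sup>2) powr (- real CARD('n) / 2))
      * gaussian (3 * \<sigma>) x"
    using c_pos[of "3 * \<sigma>"] \<sigma> by (simp add: gaussian_def c_def N_def)
qed

lemma integrable_gaussian_deriv:
  assumes \<sigma>: "\<sigma> > 0"
  shows "integrable lborel (gaussian_deriv \<sigma> :: real ^ 'n \<Rightarrow> real)"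
proof -
  obtain C where C: "\<And>s (x :: real ^ 'n). s \<in> {\<sigma>/2<..<2*\<sigma>} \<Longrightarrow> \<bar>gaussian_deriv s x\<bar> \<le> C * gaussian (3 * \<sigma>) x"
    using gaussian_deriv_bound[OF \<sigma>] by blast
  have "integrable lborel (\<lambda>x :: real ^ 'n. C * gaussian (3 * \<sigma>) x)"
    using \<sigma> by (intro integrable_mult_right integrable_gaussian) simp
  then show ?thesis
    by (rule Bochner_Integration.integrable_bound) (use \<sigma> in \<open>auto intro!: AE_I2 order_trans[OF C]\<close>)
qed

text \<open>The hypothesis on \<open>u\<close> is integrability against every Gaussian, so that the
  lemma covers both L2 functions and characters, which are not in L2. By the mean value inequality
  the difference quotients \<open>Q\<close> inherit the majorant of the derivative, and dominated
  convergence applies.\<close>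

lemma has_vector_derivative_convolution_gaussian:
  fixes u :: "real ^ 'n \<Rightarrow> complex"
  assumes \<sigma>: "\<sigma> > 0" and [measurable]: "u \<in> borel_measurable lebesgue"
    and int: "\<And>s. s > 0 \<Longrightarrow> integrable lebesgue (\<lambda>y. gaussian s (z - y) *\<^sub>R u y)"
  shows "integrable lebesgue (\<lambda>y. gaussian_deriv \<sigma> (z - y) *\<^sub>R u y)"
    and "((\<lambda>s. convolution u (gaussian s) z) has_vector_derivative convolution u (gaussian_deriv \<sigma>) z) (at \<sigma>)"
proof -
  let ?S = "{\<sigma>/2<..<2*\<sigma>}"
  obtain C where C: "\<And>s (x :: real ^ 'n). s \<in> ?S \<Longrightarrow> \<bar>gaussian_deriv s x\<bar> \<le> C * gaussian (3 * \<sigma>) x"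
    using gaussian_deriv_bound[OF \<sigma>] by blast
  have \<sigma>S: "\<sigma> \<in> ?S"
    using \<sigma> by simp
  have [measurable]: "(\<lambda>y. gaussian s (z - y)) \<in> borel_measurable lebesgue"
      "(\<lambda>y. gaussian_deriv s (z - y)) \<in> borel_measurable lebesgue" for s
    by (rule measurable_completion, measurable)+
  have dom: "integrable lebesgue (\<lambda>y. C * norm (gaussian (3 * \<sigma>) (z - y) *\<^sub>R u y))"
    using \<sigma> by (intro integrable_mult_right integrable_norm int) simp
  have bound: "norm (gaussian_deriv s (z - y) *\<^sub>R u y) \<le> C * norm (gaussian (3 * \<sigma>) (z - y) *\<^sub>R u y)"
    if "s \<in> ?S" for s y
    using mult_right_mono[OF C[OF that, of "z - y"], of "norm (u y)"] by (simp add: mult.assoc)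
  show deriv_int: "integrable lebesgue (\<lambda>y. gaussian_deriv \<sigma> (z - y) *\<^sub>R u y)"
  proof (rule Bochner_Integration.integrable_bound[OF dom])
    show "AE y in lebesgue. norm (gaussian_deriv \<sigma> (z - y) *\<^sub>R u y)
        \<le> norm (C * norm (gaussian (3 * \<sigma>) (z - y) *\<^sub>R u y))"
      unfolding real_norm_def[of "C * _"] by (intro AE_I2 order_trans[OF bound[OF \<sigma>S] abs_ge_self])
  qed measurable
  define Q where "Q s y = ((gaussian s (z - y) - gaussian \<sigma> (z - y)) / (s - \<sigma>)) *\<^sub>R u y" for s y
  have Q_bound: "norm (Q s y) \<le> C * norm (gaussian (3 * \<sigma>) (z - y) *\<^sub>R u y)" if s: "s \<in> ?S" "s \<noteq> \<sigma>" for s y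
  proof -
    have "norm (gaussian s (z - y) - gaussian \<sigma> (z - y)) \<le> C * gaussian (3 * \<sigma>) (z - y) * norm (s - \<sigma>)"
    proof (rule field_differentiable_bound[where S = ?S])
      show "((\<lambda>s. gaussian s (z - y)) has_real_derivative gaussian_deriv t (z - y)) (at t within ?S)"
        if "t \<in> ?S" for t
        using that \<sigma> by (intro has_field_derivative_at_within[OF has_real_derivative_gaussian]) auto
      show "norm (gaussian_deriv t (z - y)) \<le> C * gaussian (3 * \<sigma>) (z - y)" if "t \<in> ?S" for t
        using C[OF that] by simp
    qed (use s \<sigma>S in auto)
    then have "\<bar>(gaussian s (z - y) - gaussian \<sigma> (z - y)) / (s - \<sigma>)\<bar> \<le> C * gaussian (3 * \<sigma>) (z - y)"
      using s by (simp add: abs_divide divide_le_eq)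
    from mult_right_mono[OF this, of "norm (u y)"] show ?thesis
      by (simp add: Q_def mult.assoc)
  qed
  have Q_lim: "((\<lambda>s. Q s y) \<longlongrightarrow> gaussian_deriv \<sigma> (z - y) *\<^sub>R u y) (at \<sigma>)" for y
    unfolding Q_def using has_real_derivative_gaussian[OF \<sigma>, of "z - y"]
    by (intro tendsto_intros) (simp add: has_field_derivative_iff)
  \<comment> \<open>The majorant of \<open>Q\<close> holds only inside the window \<open>?S\<close>,
    so the limit is first taken within \<open>?S\<close>; as \<open>?S\<close> is open and contains
    \<open>\<sigma>\<close>, it is then a full limit at \<open>\<sigma>\<close>.\<close>
  have lim: "((\<lambda>s. integral\<^sup>L lebesgue (Q s)) \<longlongrightarrow> convolution u (gaussian_deriv \<sigma>) z) (at \<sigma> within ?S)"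
    unfolding tendsto_at_iff_sequentially
  proof (intro allI impI)
    fix X assume X: "\<forall>i. X i \<in> ?S - {\<sigma>}" and X_lim: "X \<longlonglongrightarrow> \<sigma>"
    have X_at: "filterlim X (at \<sigma>) sequentially"
      using X X_lim by (auto simp: filterlim_at)
    have "(\<lambda>i. integral\<^sup>L lebesgue (Q (X i))) \<longlonglongrightarrow> (LINT y|lebesgue. gaussian_deriv \<sigma> (z - y) *\<^sub>R u y)"
    proof (rule integral_dominated_convergence[OF _ _ dom])
      show "AE y in lebesgue. (\<lambda>i. Q (X i) y) \<longlonglongrightarrow> gaussian_deriv \<sigma> (z - y) *\<^sub>R u y"
        using filterlim_compose[OF Q_lim X_at] by simp
      show "AE y in lebesgue. norm (Q (X i) y) \<le> C * norm (gaussian (3 * \<sigma>) (z - y) *\<^sub>R u y)" for i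
        using X by (intro AE_I2 Q_bound) auto
      show "Q (X i) \<in> borel_measurable lebesgue" for i
        unfolding Q_def by measurable
    qed measurable
    then show "((\<lambda>s. integral\<^sup>L lebesgue (Q s)) \<circ> X) \<longlonglongrightarrow> convolution u (gaussian_deriv \<sigma>) z"
      by (simp add: o_def convolution_def)
  qed
  have Q_eq: "integral\<^sup>L lebesgue (Q s) = inverse (s - \<sigma>) *\<^sub>R (convolution u (gaussian s) z - convolution u (gaussian \<sigma>) z)"
    if "s \<in> ?S" for s
  proof -
    have "s > 0"
      using that \<sigma> by auto
    then have "convolution u (gaussian s) z - convolution u (gaussian \<sigma>) z
        = (LINT y|lebesgue. gaussian s (z - y) *\<^sub>R u y - gaussian \<sigma> (z - y) *\<^sub>R u y)"
      unfolding convolution_def using \<sigma> by (intro Bochner_Integration.integral_diff[symmetric] int)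
    moreover have "Q s = (\<lambda>y. inverse (s - \<sigma>) *\<^sub>R (gaussian s (z - y) *\<^sub>R u y - gaussian \<sigma> (z - y) *\<^sub>R u y))"
      by (simp add: Q_def fun_eq_iff scaleR_diff_left[symmetric] divide_inverse mult.commute)
    ultimately show ?thesis
      by simp
  qed
  have "((\<lambda>s. inverse (s - \<sigma>) *\<^sub>R (convolution u (gaussian s) z - convolution u (gaussian \<sigma>) z))
      \<longlongrightarrow> convolution u (gaussian_deriv \<sigma>) z) (at \<sigma> within ?S)"
    using lim by (rule Lim_transform_eventually) (auto simp: eventually_at_filter Q_eq)
  then have lim': "((\<lambda>s. inverse (s - \<sigma>) *\<^sub>R (convolution u (gaussian s) z - convolution u (gaussian \<sigma>) z))
      \<longlongrightarrow> convolution u (gaussian_deriv \<sigma>) z) (at \<sigma>)"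
    using \<sigma>S by (subst (asm) at_within_open) auto
  show "((\<lambda>s. convolution u (gaussian s) z) has_vector_derivative convolution u (gaussian_deriv \<sigma>) z) (at \<sigma>)"
    unfolding has_vector_derivative_def has_derivative_iff_norm
  proof (intro conjI bounded_linear_scaleR_left)
    have "((\<lambda>s. norm (inverse (s - \<sigma>) *\<^sub>R (convolution u (gaussian s) z - convolution u (gaussian \<sigma>) z)
        - convolution u (gaussian_deriv \<sigma>) z)) \<longlongrightarrow> 0) (at \<sigma>)"
      using tendsto_norm[OF tendsto_diff[OF lim' tendsto_const, of "convolution u (gaussian_deriv \<sigma>) z"]] by simp
    then show "((\<lambda>s. norm (convolution u (gaussian s) z - convolution u (gaussian \<sigma>) z
         - (s - \<sigma>) *\<^sub>R convolution u (gaussian_deriv \<sigma>) z) / norm (s - \<sigma>)) \<longlongrightarrow> 0) (at \<sigma>)"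
    proof (rule Lim_transform_eventually)
      have "norm (inverse (s - \<sigma>) *\<^sub>R a - b) = norm (a - (s - \<sigma>) *\<^sub>R b) / norm (s - \<sigma>)"
        if "s \<noteq> \<sigma>" for s and a b :: complex
      proof -
        have "inverse (s - \<sigma>) *\<^sub>R a - b = inverse (s - \<sigma>) *\<^sub>R (a - (s - \<sigma>) *\<^sub>R b)"
          using that by (simp add: scaleR_diff_right)
        then show ?thesis
          by (simp add: divide_inverse mult.commute abs_inverse)
      qed
      then show "\<forall>\<^sub>F s in at \<sigma>. norm (inverse (s - \<sigma>) *\<^sub>R (convolution u (gaussian s) z - convolution u (gaussian \<sigma>) z)
          - convolution u (gaussian_deriv \<sigma>) z)
        = norm (convolution u (gaussian s) z - convolution u (gaussian \<sigma>) z
         - (s - \<sigma>) *\<^sub>R convolution u (gaussian_deriv \<sigma>) z) / norm (s - \<sigma>)"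
        by (simp add: eventually_at_filter)
    qed
  qed
qed

lemma fourier_L1_gaussian:
  assumes s: "s > 0"
  shows "fourier_L1 (\<lambda>x. of_real (gaussian s x)) \<xi> = of_real (exp (- (s\<^sup>2 * (norm \<xi>)\<^sup>2) / 2))"
  by (simp add: fourier_L1_lborel integral_cis_gaussian[OF s])

lemma fourier_L1_gaussian_deriv:
  fixes \<xi> :: "real ^ 'n"
  assumes \<sigma>: "\<sigma> > 0"
  shows "fourier_L1 (\<lambda>x. of_real (gaussian_deriv \<sigma> x)) \<xi>
     = of_real (- \<sigma> * (norm \<xi>)\<^sup>2 * exp (- (\<sigma>\<^sup>2 * (norm \<xi>)\<^sup>2) / 2))"
proof -
  \<comment> \<open>At \<open>z = 0\<close> the convolution of an even kernel with the character \<open>e\<close> is the transform of the kernel at \<open>\<xi>\<close>.\<close>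
  define e where "e y = cis (- (\<xi> \<bullet> y))" for y
  have even: "gaussian s (0 - y) = gaussian s y" "gaussian_deriv s (0 - y) = gaussian_deriv s y"
    for s and y :: "real ^ 'n"
    by (simp_all add: gaussian_def gaussian_deriv_def)
  have [measurable]: "e \<in> borel_measurable borel"
    unfolding e_def by measurable
  have "integrable lebesgue (\<lambda>y. gaussian s (0 - y) *\<^sub>R e y)" if "s > 0" for s
    unfolding even e_def using integrable_cis_gaussian[OF that, of \<xi>]
    by (subst integrable_completion) (simp_all add: scaleR_conv_of_real mult.commute)
  then have deriv: "((\<lambda>s. convolution e (gaussian s) 0) has_vector_derivative convolution e (gaussian_deriv \<sigma>) 0) (at \<sigma>)"
    by (intro has_vector_derivative_convolution_gaussian \<sigma> measurable_completion) auto
  have conv: "convolution e (gaussian s) 0 = of_real (exp (- (s\<^sup>2 * (norm \<xi>)\<^sup>2) / 2))" if "s > 0" for s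
    using fourier_L1_gaussian[OF that, of \<xi>]
    unfolding convolution_def fourier_L1_def e_def even by (simp add: scaleR_conv_of_real mult.commute)
  have "((\<lambda>s. exp (- (s\<^sup>2 * (norm \<xi>)\<^sup>2) / 2)) has_real_derivative
      - \<sigma> * (norm \<xi>)\<^sup>2 * exp (- (\<sigma>\<^sup>2 * (norm \<xi>)\<^sup>2) / 2)) (at \<sigma>)"
    by (auto intro!: derivative_eq_intros)
  then have "((\<lambda>s. complex_of_real (exp (- (s\<^sup>2 * (norm \<xi>)\<^sup>2) / 2))) has_vector_derivative
      of_real (- \<sigma> * (norm \<xi>)\<^sup>2 * exp (- (\<sigma>\<^sup>2 * (norm \<xi>)\<^sup>2) / 2))) (at \<sigma>)"
    by (intro has_vector_derivative_of_real) (simp add: has_real_derivative_iff_has_vector_derivative)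
  then have "((\<lambda>s. convolution e (gaussian s) 0) has_vector_derivative
      of_real (- \<sigma> * (norm \<xi>)\<^sup>2 * exp (- (\<sigma>\<^sup>2 * (norm \<xi>)\<^sup>2) / 2))) (at \<sigma>)"
    by (rule has_vector_derivative_transform_within_open[where S = "{0<..}"]) (use \<sigma> in \<open>auto simp: conv\<close>)
  \<comment> \<open>Two derivatives of the same function of the scale are compared: one is an
    integral against \<open>gaussian_deriv\<close>, the other comes from the closed form of the
    transform.\<close>
  from vector_derivative_unique_at[OF deriv this] show ?thesis
    unfolding convolution_def fourier_L1_def e_def even by (simp add: scaleR_conv_of_real mult.commute)
qed

section \<open>Decay of the Fourier multiplier\<close>

lemma power_le_exp:
  assumes "0 \<le> (x :: real)"
  shows "x ^ m \<le> fact m * exp x"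
proof -
  have "(\<Sum>i\<in>{m}. x ^ i /\<^sub>R fact i) \<le> exp x"
    unfolding exp_def using assms by (intro sum_le_suminf summable_exp_generic) auto
  then show ?thesis
    by (simp add: divide_inverse[symmetric] field_simps)
qed

text \<open>In terms of \<open>X = 1 + (norm \<xi>)\<^sup>2\<close> the polynomial factors are at
  most a power of \<open>X\<close>. The Gaussian decay becomes
  \<open>exp (- (\<sigma>\<^sup>2 * X))\<close> at the price of the constant
  \<open>exp (\<sigma>\<^sup>2)\<close>, and a single term of the exponential series shows that it
  beats the power.\<close>

lemma sobolev_multiplier_bound:
  assumes \<sigma>: "\<sigma> > 0" and k: "k \<ge> 0"
  obtains B where "\<And>\<xi> :: real ^ 'n. (1 + (norm \<xi>)\<^sup>2) powr k *
     (norm (fourier_L1 (\<lambda>x. of_real (gaussian_deriv \<sigma> x)) \<xi>))\<^sup>2 \<le> B"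
proof
  fix \<xi> :: "real ^ 'n"
  \<comment> \<open>The real order \<open>k\<close> is rounded up to an integer exponent; the 2
    accounts for \<open>((norm \<xi>)\<^sup>2)\<^sup>2 \<le> X ^ 2\<close> in the squared
    multiplier.\<close>
  define m where "m = nat \<lceil>k\<rceil> + 2"
  define X where "X = 1 + (norm \<xi>)\<^sup>2"
  have X: "X \<ge> 1"
    by (simp add: X_def)
  have sq: "(norm (fourier_L1 (\<lambda>x. of_real (gaussian_deriv \<sigma> x)) \<xi>))\<^sup>2 = \<sigma>\<^sup>2 * ((norm \<xi>)\<^sup>2)\<^sup>2 * exp (- (\<sigma>\<^sup>2 * (norm \<xi>)\<^sup>2))"
    unfolding fourier_L1_gaussian_deriv[OF \<sigma>] norm_of_real power2_abs power_mult_distrib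
    by (simp add: exp_double[symmetric])
  have e: "exp (- (\<sigma>\<^sup>2 * (norm \<xi>)\<^sup>2)) = exp (\<sigma>\<^sup>2) * exp (- (\<sigma>\<^sup>2 * X))"
    by (simp add: X_def exp_add[symmetric] algebra_simps)
  have "X powr k \<le> X powr real (nat \<lceil>k\<rceil>)"
    using X k by (intro powr_mono) linarith+
  then have 1: "X powr k \<le> X ^ nat \<lceil>k\<rceil>"
    using X by (simp add: powr_realpow)
  have 2: "((norm \<xi>)\<^sup>2)\<^sup>2 \<le> X ^ 2"
    by (intro power_mono) (auto simp: X_def)
  have "(\<sigma>\<^sup>2 * X) ^ m \<le> fact m * exp (\<sigma>\<^sup>2 * X)"
    using X by (intro power_le_exp) auto
  then have 3: "X ^ m * exp (- (\<sigma>\<^sup>2 * X)) \<le> fact m / (\<sigma>\<^sup>2) ^ m"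
    using \<sigma> by (simp add: power_mult_distrib exp_minus field_simps)
  have "X powr k * (\<sigma>\<^sup>2 * ((norm \<xi>)\<^sup>2)\<^sup>2 * exp (- (\<sigma>\<^sup>2 * (norm \<xi>)\<^sup>2)))
      = (X powr k * ((norm \<xi>)\<^sup>2)\<^sup>2) * exp (- (\<sigma>\<^sup>2 * X)) * (\<sigma>\<^sup>2 * exp (\<sigma>\<^sup>2))"
    unfolding e by simp
  also have "\<dots> \<le> (X ^ nat \<lceil>k\<rceil> * X ^ 2) * exp (- (\<sigma>\<^sup>2 * X)) * (\<sigma>\<^sup>2 * exp (\<sigma>\<^sup>2))"
    using X by (intro mult_right_mono mult_mono 1 2) auto
  also have "\<dots> \<le> fact m / (\<sigma>\<^sup>2) ^ m * (\<sigma>\<^sup>2 * exp (\<sigma>\<^sup>2))"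
    using 3 by (intro mult_right_mono) (auto simp: m_def power_add[symmetric])
  finally show "(1 + (norm \<xi>)\<^sup>2) powr k * (norm (fourier_L1 (\<lambda>x. of_real (gaussian_deriv \<sigma> x)) \<xi>))\<^sup>2
       \<le> fact (nat \<lceil>k\<rceil> + 2) / (\<sigma>\<^sup>2) ^ (nat \<lceil>k\<rceil> + 2) * (\<sigma>\<^sup>2 * exp (\<sigma>\<^sup>2))"
    unfolding sq by (simp add: X_def m_def)
qed

section \<open>The Fourier transform of square integrable functions\<close>

lemma L2sq_lebesgue: "L2sq lebesgue f = L2sq lborel f"
  by (simp add: L2sq_def nn_integral_completion)

lemma L2sq_mono: "(\<And>x. norm (f x) \<le> norm (g x)) \<Longrightarrow> L2sq M f \<le> L2sq M g"
  unfolding L2sq_def by (intro nn_integral_mono ennreal_leI power_mono) auto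

lemma L2_space_iff: "u \<in> L2_space \<longleftrightarrow> u \<in> borel_measurable lebesgue \<and> L2sq lborel u < \<infinity>"
proof -
  have "L2sq lborel u = (\<integral>\<^sup>+x. ennreal ((norm (u x))\<^sup>2) \<partial>lebesgue)"
    by (simp add: L2sq_def nn_integral_completion)
  then show ?thesis
    by (auto simp: L2_space_def integrable_iff_bounded)
qed

lemma L2sq_eq_L2_norm:
  assumes "u \<in> L2_space"
  shows "L2sq lborel u = ennreal ((L2_norm u)\<^sup>2)"
proof -
  have "integrable lebesgue (\<lambda>x. (norm (u x))\<^sup>2)"
    using assms by (simp add: L2_space_def)
  then show ?thesis
    by (subst L2sq_lebesgue[symmetric]) (simp add: L2sq_def L2_norm_def nn_integral_eq_integral)
qed

text \<open>\<open>lebesgue\<close> is the completion of \<open>lborel\<close>; real and imaginary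
  parts are corrected on null sets separately.\<close>

lemma lebesgue_borel_representative:
  fixes u :: "'a::euclidean_space \<Rightarrow> complex"
  assumes u: "u \<in> borel_measurable lebesgue"
  obtains v where "v \<in> borel_measurable borel" "AE x in lebesgue. u x = v x"
proof -
  have "(\<lambda>x. Re (u x)) \<in> borel_measurable lebesgue" "(\<lambda>x. Im (u x)) \<in> borel_measurable lebesgue"
    using u by measurable
  then obtain a b where ab: "a \<in> borel_measurable lborel" "AE x in lborel. Re (u x) = a x"
      "b \<in> borel_measurable lborel" "AE x in lborel. Im (u x) = b x"
    using completion_ex_borel_measurable_real by metis
  then have [measurable]: "a \<in> borel_measurable borel" "b \<in> borel_measurable borel"
    by simp_all
  show ?thesis
  proof
    show "(\<lambda>x. of_real (a x) + \<i> * of_real (b x)) \<in> borel_measurable borel"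
      by measurable
    have "AE x in lborel. u x = of_real (a x) + \<i> * of_real (b x)"
      using ab(2,4) by eventually_elim (simp add: complex_eq_iff)
    then show "AE x in lebesgue. u x = of_real (a x) + \<i> * of_real (b x)"
      by (rule AE_completion)
  qed
qed

text \<open>The equality holds at every \<open>z\<close>, so passing to a Borel representative
  leaves the texture itself unchanged, not only its class.\<close>

lemma convolution_cong_AE:
  assumes [measurable]: "u \<in> borel_measurable lebesgue" "v \<in> borel_measurable lebesgue" "\<phi> \<in> borel_measurable borel"
    and eq: "AE x in lebesgue. u x = v x"
  shows "convolution u \<phi> z = convolution v \<phi> z"
proof -
  have [measurable]: "(\<lambda>y. \<phi> (z - y)) \<in> borel_measurable lebesgue"
    by (rule measurable_completion) measurable
  show ?thesis
    unfolding convolution_def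
    by (rule integral_cong_AE) (use eq in \<open>measurable, auto\<close>)
qed

lemma fourier_L1_cong_AE:
  fixes u v :: "real ^ 'n \<Rightarrow> complex"
  assumes [measurable]: "u \<in> borel_measurable lebesgue" "v \<in> borel_measurable lebesgue"
    and eq: "AE x in lebesgue. u x = v x"
  shows "fourier_L1 u = fourier_L1 v"
proof
  fix \<xi> :: "real ^ 'n"
  have [measurable]: "(\<lambda>x. cis (- (\<xi> \<bullet> x))) \<in> borel_measurable lebesgue"
    by (rule measurable_completion) measurable
  show "fourier_L1 u \<xi> = fourier_L1 v \<xi>"
    unfolding fourier_L1_def
    by (rule integral_cong_AE) (use eq in \<open>measurable, auto\<close>)
qed

section \<open>Truncations and the Plancherel transform\<close>

definition truncation :: "real \<Rightarrow> (real ^ 'n \<Rightarrow> complex) \<Rightarrow> real ^ 'n \<Rightarrow> complex" where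
  "truncation R u = (\<lambda>x. indicator (cball 0 R) x *\<^sub>R u x)"

lemma has_fourier_L2_iff:
  "has_fourier_L2 f g \<longleftrightarrow> g \<in> L2_space \<and>
     ((\<lambda>R. L2sq lebesgue (\<lambda>\<xi>. g \<xi> - fourier_L1 (truncation R f) \<xi>)) \<longlongrightarrow> 0) at_top"
  by (simp add: has_fourier_L2_def L2sq_def truncation_def)

lemma borel_measurable_truncation [measurable]:
  fixes u :: "real ^ 'n \<Rightarrow> complex"
  assumes [measurable]: "u \<in> borel_measurable borel"
  shows "truncation R u \<in> borel_measurable borel"
proof -
  have [measurable]: "(indicator (cball 0 R) :: real ^ 'n \<Rightarrow> real) \<in> borel_measurable borel"
    by (intro borel_measurable_indicator) simp
  show ?thesis
    unfolding truncation_def by measurable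
qed

lemma borel_measurable_truncation_lebesgue [measurable]:
  fixes u :: "real ^ 'n \<Rightarrow> complex"
  assumes [measurable]: "u \<in> borel_measurable lebesgue"
  shows "truncation R u \<in> borel_measurable lebesgue"
proof -
  have [measurable]: "(indicator (cball 0 R) :: real ^ 'n \<Rightarrow> real) \<in> borel_measurable lebesgue"
    by (intro measurable_completion borel_measurable_indicator) simp
  show ?thesis
    unfolding truncation_def by measurable
qed

lemma fourier_L1_truncation_cong_AE:
  assumes u: "u \<in> borel_measurable lebesgue" and v: "v \<in> borel_measurable lebesgue"
    and eq: "AE x in lebesgue. u x = v x"
  shows "fourier_L1 (truncation R u) = fourier_L1 (truncation R v)"
  by (rule fourier_L1_cong_AE) (use u v eq in \<open>auto simp: truncation_def elim!: eventually_mono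
    intro: borel_measurable_truncation_lebesgue[unfolded truncation_def]\<close>)

text \<open>Both functions are compared with the transform of the same truncation, and the two
  errors vanish as the radius grows. This is what gives \<open>fourier_L2\<close>, a choice by
  \<open>SOME\<close>, a definite value a.e.\<close>

lemma has_fourier_L2_unique:
  assumes f: "f \<in> borel_measurable lebesgue" and g: "has_fourier_L2 f g" and h: "has_fourier_L2 f h"
  shows "AE \<xi> in lebesgue. g \<xi> = h \<xi>"
proof -
  obtain v where v: "v \<in> borel_measurable borel" "AE x in lebesgue. f x = v x"
    using lebesgue_borel_representative[OF f] .
  define F where "F R = fourier_L1 (truncation R f)" for R
  have F_eq: "F R = fourier_L1 (truncation R v)" for R
    unfolding F_def using f v by (intro fourier_L1_truncation_cong_AE) (auto intro: measurable_completion)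
  have [measurable]: "F R \<in> borel_measurable lebesgue" for R
    unfolding F_eq using v by (intro measurable_completion) (simp add: borel_measurable_fourier_L1)
  have [measurable]: "g \<in> borel_measurable lebesgue" "h \<in> borel_measurable lebesgue"
    using g h by (auto simp: has_fourier_L2_iff L2_space_iff)
  have "((\<lambda>R. L2sq lebesgue (\<lambda>\<xi>. g \<xi> - F R \<xi>)) \<longlongrightarrow> 0) at_top" "((\<lambda>R. L2sq lebesgue (\<lambda>\<xi>. h \<xi> - F R \<xi>)) \<longlongrightarrow> 0) at_top"
    using g h by (auto simp: has_fourier_L2_iff F_def)
  then have "((\<lambda>R. 2 * L2sq lebesgue (\<lambda>\<xi>. g \<xi> - F R \<xi>) + 2 * L2sq lebesgue (\<lambda>\<xi>. h \<xi> - F R \<xi>)) \<longlongrightarrow> 2 * 0 + 2 * 0) at_top"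
    by (intro tendsto_add ennreal_tendsto_cmult) auto
  then have "L2sq lebesgue (\<lambda>\<xi>. g \<xi> - h \<xi>) \<le> 2 * 0 + 2 * 0"
  proof (rule tendsto_lowerbound)
    show "\<forall>\<^sub>F R in at_top. L2sq lebesgue (\<lambda>\<xi>. g \<xi> - h \<xi>) \<le>
        2 * L2sq lebesgue (\<lambda>\<xi>. g \<xi> - F R \<xi>) + 2 * L2sq lebesgue (\<lambda>\<xi>. h \<xi> - F R \<xi>)"
      using L2sq_triangle[of g lebesgue "F _" h] by (simp add: L2sq_diff_commute[of lebesgue h])
  qed simp
  then have "L2sq lebesgue (\<lambda>\<xi>. g \<xi> - h \<xi>) = 0"
    by simp
  then show ?thesis
    unfolding L2sq_def by (subst (asm) nn_integral_0_iff_AE) auto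
qed

text \<open>On the ball, which has finite measure, \<open>norm (u x)\<close> is at most
  \<open>1 + (norm (u x))\<^sup>2\<close>.\<close>

lemma integrable_truncation:
  assumes [measurable]: "u \<in> borel_measurable borel" and fin: "L2sq lborel u < \<infinity>"
  shows "integrable lborel (truncation R u)"
proof -
  have "integrable lborel (\<lambda>x. (norm (u x))\<^sup>2)"
    using fin by (simp add: integrable_iff_bounded L2sq_def)
  moreover have "integrable lborel (indicator (cball 0 R) :: real ^ 'n \<Rightarrow> real)"
    using emeasure_lborel_cball_finite by (intro integrable_real_indicator) auto
  ultimately have "integrable lborel (\<lambda>x. indicator (cball 0 R) x + (norm (u x))\<^sup>2)"
    by (intro Bochner_Integration.integrable_add)
  then show ?thesis
  proof (rule Bochner_Integration.integrable_bound)
    have "norm (truncation R u x) \<le> indicator (cball 0 R) x + (norm (u x))\<^sup>2" for x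
    proof -
      have "norm (u x) \<le> 1 + (norm (u x))\<^sup>2"
        using sum_squares_bound[of 1 "norm (u x)"] norm_ge_zero[of "u x"]
        unfolding power_one mult_1_right by linarith
      then show ?thesis
        by (auto simp: truncation_def indicator_def)
    qed
    then show "AE x in lborel. norm (truncation R u x) \<le> norm (indicator (cball 0 R) x + (norm (u x))\<^sup>2)"
      by (intro AE_I2) (metis abs_ge_self order_trans real_norm_def)
  qed measurable
qed

lemma L2sq_truncation_tendsto:
  fixes u :: "real ^ 'n \<Rightarrow> complex"
  assumes [measurable]: "u \<in> borel_measurable borel" and fin: "L2sq lborel u < \<infinity>"
  shows "((\<lambda>R. L2sq lborel (\<lambda>x. u x - truncation R u x)) \<longlongrightarrow> 0) at_top"
proof -
  have int: "integrable lborel (\<lambda>x. (norm (u x))\<^sup>2)"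
    using fin by (simp add: integrable_iff_bounded L2sq_def)
  have le: "norm ((norm (u x - truncation R u x))\<^sup>2) \<le> (norm (u x))\<^sup>2" for x R
    by (auto simp: truncation_def indicator_def)
  have "((\<lambda>R. LINT x|lborel. (norm (u x - truncation R u x))\<^sup>2) \<longlongrightarrow> (LINT x|(lborel :: (real ^ 'n) measure). 0 :: real)) at_top"
  proof (rule integral_dominated_convergence_at_top[where w = "\<lambda>x. (norm (u x))\<^sup>2"])
    show "\<forall>\<^sub>F R in at_top. AE x in lborel. norm ((norm (u x - truncation R u x))\<^sup>2) \<le> (norm (u x))\<^sup>2"
      using le by simp
    show "AE x in lborel. ((\<lambda>R. (norm (u x - truncation R u x))\<^sup>2) \<longlongrightarrow> 0) at_top"
    proof (rule AE_I2)
      fix x :: "real ^ 'n"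
      have "\<forall>\<^sub>F R in at_top. (norm (u x - truncation R u x))\<^sup>2 = 0"
        using eventually_ge_at_top[of "norm x"] by eventually_elim (simp add: truncation_def)
      then show "((\<lambda>R. (norm (u x - truncation R u x))\<^sup>2) \<longlongrightarrow> 0) at_top"
        by (rule tendsto_eventually)
    qed
  qed (use int in measurable)
  then have "((\<lambda>R. ennreal (LINT x|lborel. (norm (u x - truncation R u x))\<^sup>2)) \<longlongrightarrow> ennreal 0) at_top"
    by (intro tendsto_intros) simp
  moreover have "L2sq lborel (\<lambda>x. u x - truncation R u x) = ennreal (LINT x|lborel. (norm (u x - truncation R u x))\<^sup>2)" for R
    unfolding L2sq_def
  proof (rule nn_integral_eq_integral)
    show "integrable lborel (\<lambda>x. (norm (u x - truncation R u x))\<^sup>2)"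
      by (rule Bochner_Integration.integrable_bound[OF int]) (use le in auto)
  qed simp
  ultimately show ?thesis
    by simp
qed

lemma L2sq_fourier_L1_diff_le:
  fixes f g :: "real ^ 'n \<Rightarrow> complex"
  assumes f: "integrable lborel f" and g: "integrable lborel g"
  shows "L2sq lborel (\<lambda>\<xi>. fourier_L1 f \<xi> - fourier_L1 g \<xi>)
     \<le> ennreal ((2 * pi) ^ CARD('n)) * L2sq lborel (\<lambda>x. f x - g x)"
proof -
  have [measurable]: "f \<in> borel_measurable borel" "g \<in> borel_measurable borel"
    using f g by (auto intro: borel_measurable_integrable_lborel)
  have "integrable lborel (\<lambda>x. cis (- (\<xi> \<bullet> x)) * h x)" if "integrable lborel h" for \<xi> and h :: "real ^ 'n \<Rightarrow> complex"
    by (rule integrable_mult_bounded[OF that, where C = 1]) auto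
  then have "fourier_L1 f \<xi> - fourier_L1 g \<xi> = fourier_L1 (\<lambda>x. f x - g x) \<xi>" for \<xi>
    using f g by (simp add: fourier_L1_lborel right_diff_distrib)
  then show ?thesis
    using L2sq_fourier_L1_le[of "\<lambda>x. f x - g x"] f g by simp
qed

text \<open>By Plancherel's inequality the transforms of the truncations form a Cauchy family whose
  error \<open>d R\<close> is governed by the tail of \<open>u\<close>. Radii with errors at most
  \<open>(1/4)^j\<close> yield an a.e. limit \<open>g\<close>; Fatou's lemma transfers the error
  bound to \<open>g\<close> for every \<open>R\<close>, so the whole family converges and not only
  the chosen sequence.\<close>

lemma fourier_L2_exists:
  fixes u :: "real ^ 'n \<Rightarrow> complex"
  assumes [measurable]: "u \<in> borel_measurable borel" and fin: "L2sq lborel u < \<infinity>"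
  obtains g where "g \<in> borel_measurable borel" "has_fourier_L2 u g"
    "L2sq lborel g \<le> ennreal ((2 * pi) ^ CARD('n)) * L2sq lborel u"
proof -
  define K where "K = ennreal ((2 * pi) ^ CARD('n))"
  have K: "K < top"
    by (simp add: K_def)
  define F where "F R = fourier_L1 (truncation R u)" for R
  define d where "d R = K * L2sq lborel (\<lambda>x. u x - truncation R u x)" for R
  have [measurable]: "F R \<in> borel_measurable borel" for R
    unfolding F_def by (intro borel_measurable_fourier_L1) measurable
  have F_diff: "L2sq lborel (\<lambda>\<xi>. F S \<xi> - F R \<xi>) \<le> d R" if "R \<le> S" for R S
  proof -
    have "L2sq lborel (\<lambda>\<xi>. F S \<xi> - F R \<xi>) \<le> K * L2sq lborel (\<lambda>x. truncation S u x - truncation R u x)"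
      unfolding F_def K_def by (intro L2sq_fourier_L1_diff_le integrable_truncation fin) auto
    also have "\<dots> \<le> d R"
      unfolding d_def using that
      by (intro mult_left_mono L2sq_mono) (auto simp: truncation_def indicator_def)
    finally show ?thesis .
  qed
  have d_lim: "(d \<longlongrightarrow> 0) at_top"
    using ennreal_tendsto_cmult[OF K L2sq_truncation_tendsto[OF _ fin]] by (simp add: d_def[abs_def])
  have "\<exists>r. \<forall>R\<ge>r. d R \<le> ennreal ((1/4)^j)" for j
  proof -
    have "\<forall>\<^sub>F R in at_top. d R < ennreal ((1/4)^j)"
      using d_lim by (rule order_tendstoD) simp
    then show ?thesis
      unfolding eventually_at_top_linorder by (auto intro: less_imp_le)
  qed
  then obtain r where r: "\<And>j R. R \<ge> r j \<Longrightarrow> d R \<le> ennreal ((1/4)^j)"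
    by metis
  \<comment> \<open>Summing the \<open>\<bar>r i\<bar>\<close> makes the radii increasing and at
    least \<open>r j\<close>; the summand \<open>real j\<close> sends them to infinity.\<close>
  define \<rho> where "\<rho> j = real j + (\<Sum>i\<le>j. \<bar>r i\<bar>)" for j
  have \<rho>_r: "r j \<le> \<rho> j" for j
    using member_le_sum[of j "{..j}" "\<lambda>i. \<bar>r i\<bar>"] by (simp add: \<rho>_def)
  have \<rho>_Suc: "\<rho> j \<le> \<rho> (Suc j)" for j
    by (simp add: \<rho>_def)
  have \<rho>_ge: "real j \<le> \<rho> j" for j
    by (simp add: \<rho>_def sum_nonneg)
  obtain g where [measurable]: "g \<in> borel_measurable lborel" and g: "AE \<xi> in lborel. (\<lambda>j. F (\<rho> j) \<xi>) \<longlonglongrightarrow> g \<xi>"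
  proof (rule convergent_if_L2sq_increments[of "\<lambda>j. F (\<rho> j)" lborel])
    show "L2sq lborel (\<lambda>\<xi>. F (\<rho> (Suc j)) \<xi> - F (\<rho> j) \<xi>) \<le> ennreal ((1/4)^j)" for j
      using F_diff[OF \<rho>_Suc] r[OF \<rho>_r] by (rule order_trans)
  qed auto
  have g_diff: "L2sq lborel (\<lambda>\<xi>. g \<xi> - F R \<xi>) \<le> d R" for R
  proof -
    have "L2sq lborel (\<lambda>\<xi>. g \<xi> - F R \<xi>) \<le> liminf (\<lambda>j. L2sq lborel (\<lambda>\<xi>. F (\<rho> j) \<xi> - F R \<xi>))"
    proof (rule L2sq_le_liminf)
      show "AE \<xi> in lborel. (\<lambda>j. F (\<rho> j) \<xi> - F R \<xi>) \<longlonglongrightarrow> g \<xi> - F R \<xi>"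
        using g by eventually_elim (intro tendsto_intros)
    qed measurable
    also have "\<dots> \<le> liminf (\<lambda>j. d R)"
    proof (rule Liminf_mono)
      show "\<forall>\<^sub>F j in sequentially. L2sq lborel (\<lambda>\<xi>. F (\<rho> j) \<xi> - F R \<xi>) \<le> d R"
        using eventually_ge_at_top[of "nat \<lceil>R\<rceil>"]
      proof eventually_elim
        case (elim j)
        then have "R \<le> real j"
          by linarith
        then show ?case
          using \<rho>_ge[of j] by (intro F_diff) simp
      qed
    qed
    finally show ?thesis
      by (simp add: Liminf_const)
  qed
  \<comment> \<open>The ball of radius \<open>-1\<close> is empty, so \<open>g_diff\<close> contains the bound on \<open>g\<close> itself.\<close>
  have "truncation (-1) u = (\<lambda>x. 0)"
    by (simp add: truncation_def)
  then have g_le: "L2sq lborel g \<le> K * L2sq lborel u"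
    using g_diff[of "-1"] by (simp add: F_def d_def fourier_L1_def)
  also have "\<dots> < \<infinity>"
    using K fin by (simp add: ennreal_mult_less_top)
  finally have "g \<in> L2_space"
    by (simp add: L2_space_iff measurable_completion)
  moreover have "((\<lambda>R. L2sq lebesgue (\<lambda>\<xi>. g \<xi> - F R \<xi>)) \<longlongrightarrow> 0) at_top"
    unfolding L2sq_lebesgue
    by (rule tendsto_sandwich[OF _ _ tendsto_const d_lim]) (simp_all add: g_diff)
  ultimately have "has_fourier_L2 u g"
    by (simp add: has_fourier_L2_iff F_def)
  with g_le show ?thesis
    by (intro that[of g]) (simp_all add: K_def)
qed

text \<open>The convolution theorem for integrable functions identifies \<open>m * U R\<close> with
  the transform of \<open>c R\<close>, the convolution of a truncation of \<open>u\<close>, while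
  the goal concerns truncations of \<open>f\<close>. The chain from \<open>m * g\<close> over
  \<open>m * U R\<close> to \<open>V S\<close> links the two: Plancherel's inequality bounds its
  last link by the distance from \<open>c R\<close> to \<open>truncation S f\<close>, which is
  estimated through \<open>f\<close>.\<close>

lemma has_fourier_L2_convolution:
  fixes u g :: "real ^ 'n \<Rightarrow> complex"
  assumes [measurable]: "u \<in> borel_measurable borel" and fin: "L2sq lborel u < \<infinity>"
    and \<phi>: "integrable lborel \<phi>" and int: "\<And>z. integrable lborel (\<lambda>y. \<phi> (z - y) *\<^sub>R u y)"
    and [measurable]: "g \<in> borel_measurable borel" and g: "has_fourier_L2 u g"
  shows "convolution u \<phi> \<in> L2_space"
    and "has_fourier_L2 (convolution u \<phi>) (\<lambda>\<xi>. fourier_L1 (\<lambda>x. of_real (\<phi> x)) \<xi> * g \<xi>)"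
proof -
  have [measurable]: "\<phi> \<in> borel_measurable borel"
    using \<phi> by (rule borel_measurable_integrable_lborel)
  define K where "K = ennreal ((2 * pi) ^ CARD('n))"
  have K: "K < top"
    by (simp add: K_def)
  define A where "A = (\<integral>\<^sup>+y. ennreal \<bar>\<phi> y\<bar> \<partial>lborel)"
  have "A < top"
    using \<phi> by (simp add: A_def integrable_iff_bounded)
  then have A: "A\<^sup>2 < top"
    by (simp add: power2_eq_square ennreal_mult_less_top)
  define m where "m = fourier_L1 (\<lambda>x. of_real (\<phi> x) :: complex)"
  obtain B where B: "\<And>\<xi>. norm (m \<xi>) \<le> B"
    using norm_fourier_L1_le[of "\<lambda>x. of_real (\<phi> x)"] unfolding m_def by blast
  have [measurable]: "m \<in> borel_measurable borel"
    unfolding m_def by (intro borel_measurable_fourier_L1) measurable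
  define f where "f = convolution u \<phi>"
  have [measurable]: "f \<in> borel_measurable borel"
    unfolding f_def by (intro borel_measurable_convolution) auto
  have "L2sq lborel f \<le> A\<^sup>2 * L2sq lborel u"
    unfolding f_def A_def by (rule L2sq_convolution_le) auto
  also have "\<dots> < \<infinity>"
    using A fin by (simp add: ennreal_mult_less_top)
  finally have f_fin: "L2sq lborel f < \<infinity>" .
  then show "convolution u \<phi> \<in> L2_space"
    unfolding f_def[symmetric] by (simp add: L2_space_iff measurable_completion)
  define U where "U R = fourier_L1 (truncation R u)" for R
  define V where "V S = fourier_L1 (truncation S f)" for S
  define c where "c R = convolution (truncation R u) \<phi>" for R
  have [measurable]: "c R \<in> borel_measurable borel" "U R \<in> borel_measurable borel" "V R \<in> borel_measurable borel" for R
    unfolding c_def U_def V_def by (intro borel_measurable_convolution borel_measurable_fourier_L1; measurable)+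
  have u_int: "integrable lborel (truncation R u)" for R
    by (rule integrable_truncation[OF _ fin]) measurable
  have c_int: "integrable lborel (c R)" for R
    unfolding c_def by (rule integrable_convolution[OF \<phi> u_int])
  have f_int: "integrable lborel (truncation S f)" for S
    by (rule integrable_truncation[OF _ f_fin]) measurable
  have c_diff: "L2sq lborel (\<lambda>z. f z - c R z) \<le> A\<^sup>2 * L2sq lborel (\<lambda>x. u x - truncation R u x)" for R
  proof -
    \<comment> \<open>Integrability at each \<open>z\<close> makes the convolution additive there;
      otherwise the Bochner integrals could take the default value 0.\<close>
    have "integrable lborel (\<lambda>y. \<phi> (z - y) *\<^sub>R truncation R u y)" for z
      using integrable_mult_indicator[OF _ int[of z], of "cball 0 R"]
      by (simp add: truncation_def mult.commute)
    then have "f z - c R z = convolution (\<lambda>x. u x - truncation R u x) \<phi> z" for z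
      using int by (simp add: f_def c_def convolution_lborel scaleR_diff_right)
    then show ?thesis
      using L2sq_convolution_le[of \<phi> "\<lambda>x. u x - truncation R u x"] by (simp add: A_def)
  qed
  have le: "L2sq lborel (\<lambda>\<xi>. m \<xi> * g \<xi> - V S \<xi>) \<le> 4 * (K * L2sq lborel (\<lambda>z. f z - truncation S f z))" for S
  proof -
    \<comment> \<open>\<open>e R\<close> collects the terms that vanish as \<open>R\<close> grows
      with \<open>S\<close> fixed. Each 4 stems from two nested triangle inequalities with factor
      2.\<close>
    define e where "e R = 2 * (ennreal (B\<^sup>2) * L2sq lborel (\<lambda>\<xi>. g \<xi> - U R \<xi>))
        + 4 * (K * (A\<^sup>2 * L2sq lborel (\<lambda>x. u x - truncation R u x)))" for R
    have "L2sq lborel (\<lambda>\<xi>. m \<xi> * g \<xi> - V S \<xi>) \<le> e R + 4 * (K * L2sq lborel (\<lambda>z. f z - truncation S f z))" for R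
    proof -
      let ?t = "A\<^sup>2 * L2sq lborel (\<lambda>x. u x - truncation R u x)"
      let ?s = "L2sq lborel (\<lambda>z. f z - truncation S f z)"
      have "L2sq lborel (\<lambda>z. c R z - truncation S f z) \<le> 2 * L2sq lborel (\<lambda>z. c R z - f z) + 2 * ?s"
        by (rule L2sq_triangle) measurable
      also have "\<dots> \<le> 2 * ?t + 2 * ?s"
        using c_diff[of R] by (subst L2sq_diff_commute) (intro add_mono mult_left_mono; simp)
      finally have *: "K * L2sq lborel (\<lambda>z. c R z - truncation S f z) \<le> K * (2 * ?t + 2 * ?s)"
        by (rule mult_left_mono) simp
      have "m \<xi> * U R \<xi> = fourier_L1 (c R) \<xi>" for \<xi>
        unfolding m_def U_def c_def by (rule fourier_L1_convolution[OF \<phi> u_int, symmetric])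
      then have "L2sq lborel (\<lambda>\<xi>. m \<xi> * U R \<xi> - V S \<xi>) \<le> K * L2sq lborel (\<lambda>z. c R z - truncation S f z)"
        unfolding V_def K_def using L2sq_fourier_L1_diff_le[OF c_int f_int] by simp
      from this and * have "L2sq lborel (\<lambda>\<xi>. m \<xi> * U R \<xi> - V S \<xi>) \<le> K * (2 * ?t + 2 * ?s)"
        by (rule order_trans)
      moreover have "L2sq lborel (\<lambda>\<xi>. m \<xi> * g \<xi> - m \<xi> * U R \<xi>) \<le> ennreal (B\<^sup>2) * L2sq lborel (\<lambda>\<xi>. g \<xi> - U R \<xi>)"
        unfolding right_diff_distrib[symmetric] by (rule L2sq_mult_le[OF _ B]) measurable
      ultimately have "2 * L2sq lborel (\<lambda>\<xi>. m \<xi> * g \<xi> - m \<xi> * U R \<xi>) + 2 * L2sq lborel (\<lambda>\<xi>. m \<xi> * U R \<xi> - V S \<xi>)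
          \<le> 2 * (ennreal (B\<^sup>2) * L2sq lborel (\<lambda>\<xi>. g \<xi> - U R \<xi>)) + 2 * (K * (2 * ?t + 2 * ?s))"
        by (intro add_mono mult_left_mono) auto
      also have "2 * (K * (2 * ?t + 2 * ?s)) = 4 * (K * ?t) + 4 * (K * ?s)"
        by (simp add: algebra_simps)
      finally have "2 * L2sq lborel (\<lambda>\<xi>. m \<xi> * g \<xi> - m \<xi> * U R \<xi>) + 2 * L2sq lborel (\<lambda>\<xi>. m \<xi> * U R \<xi> - V S \<xi>)
          \<le> e R + 4 * (K * ?s)"
        by (simp add: e_def add.assoc)
      moreover have "L2sq lborel (\<lambda>\<xi>. m \<xi> * g \<xi> - V S \<xi>)
        \<le> 2 * L2sq lborel (\<lambda>\<xi>. m \<xi> * g \<xi> - m \<xi> * U R \<xi>) + 2 * L2sq lborel (\<lambda>\<xi>. m \<xi> * U R \<xi> - V S \<xi>)"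
        by (rule L2sq_triangle) measurable
      ultimately show ?thesis
        by (rule order_trans[rotated])
    qed
    moreover have "(e \<longlongrightarrow> 2 * (ennreal (B\<^sup>2) * 0) + 4 * (K * (A\<^sup>2 * 0))) at_top"
      unfolding e_def using g L2sq_truncation_tendsto[OF _ fin] A K
      by (intro tendsto_add ennreal_tendsto_cmult) (auto simp: has_fourier_L2_iff U_def L2sq_lebesgue)
    then have "((\<lambda>R. e R + 4 * (K * L2sq lborel (\<lambda>z. f z - truncation S f z))) \<longlongrightarrow>
       0 + 4 * (K * L2sq lborel (\<lambda>z. f z - truncation S f z))) at_top"
      by (intro tendsto_add tendsto_const) simp
    ultimately have "L2sq lborel (\<lambda>\<xi>. m \<xi> * g \<xi> - V S \<xi>) \<le> 0 + 4 * (K * L2sq lborel (\<lambda>z. f z - truncation S f z))"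
      by (intro tendsto_lowerbound) auto
    then show ?thesis
      by simp
  qed
  have "((\<lambda>S. 4 * (K * L2sq lborel (\<lambda>z. f z - truncation S f z))) \<longlongrightarrow> 4 * (K * 0)) at_top"
    using L2sq_truncation_tendsto[OF _ f_fin] K by (intro ennreal_tendsto_cmult) auto
  then have lim: "((\<lambda>S. 4 * (K * L2sq lborel (\<lambda>z. f z - truncation S f z))) \<longlongrightarrow> 0) at_top"
    by simp
  have "((\<lambda>S. L2sq lborel (\<lambda>\<xi>. m \<xi> * g \<xi> - V S \<xi>)) \<longlongrightarrow> 0) at_top"
    by (rule tendsto_sandwich[OF _ _ tendsto_const lim]) (simp_all add: le)
  moreover have "(\<lambda>\<xi>. m \<xi> * g \<xi>) \<in> L2_space"
  proof -
    have "L2sq lborel (\<lambda>\<xi>. m \<xi> * g \<xi>) \<le> ennreal (B\<^sup>2) * L2sq lborel g"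
      by (rule L2sq_mult_le[OF _ B]) measurable
    also have "\<dots> < \<infinity>"
      using g by (simp add: ennreal_mult_less_top has_fourier_L2_iff L2_space_iff)
    finally show ?thesis
      by (simp add: L2_space_iff measurable_completion)
  qed
  ultimately show "has_fourier_L2 (convolution u \<phi>) (\<lambda>\<xi>. fourier_L1 (\<lambda>x. of_real (\<phi> x)) \<xi> * g \<xi>)"
    by (simp add: has_fourier_L2_iff L2sq_lebesgue m_def f_def V_def)
qed

section \<open>The texture operator\<close>

text \<open>The product is at most the sum of the two squares, and the square of the Gaussian is at
  most its peak value \<open>c\<close> times the Gaussian, hence integrable.\<close>

lemma integrable_gaussian_scaleR_L2:
  fixes u :: "real ^ 'n \<Rightarrow> complex"
  assumes u: "u \<in> L2_space" and s: "s > 0"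
  shows "integrable lebesgue (\<lambda>y. gaussian s (z - y) *\<^sub>R u y)"
proof -
  define c where "c = (2 * pi * s\<^sup>2) powr (- real CARD('n) / 2)"
  have [measurable]: "u \<in> borel_measurable lebesgue"
    using u by (simp add: L2_space_def)
  have [measurable]: "(\<lambda>y. gaussian s (z - y)) \<in> borel_measurable lebesgue"
    by (rule measurable_completion) measurable
  have le: "gaussian s x \<le> c" for x :: "real ^ 'n"
    unfolding gaussian_def c_def by (intro mult_left_le) auto
  have "integrable lebesgue (\<lambda>y. gaussian s (z - y))"
    using integrable_lborel_reflect[OF integrable_gaussian[OF s], of z]
    by (subst integrable_completion) simp_all
  then have "integrable lebesgue (\<lambda>y. c * gaussian s (z - y) + (norm (u y))\<^sup>2)"
    using u by (intro Bochner_Integration.integrable_add integrable_mult_right) (auto simp: L2_space_def)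
  then show ?thesis
  proof (rule Bochner_Integration.integrable_bound)
    have "norm (gaussian s (z - y) *\<^sub>R u y) \<le> c * gaussian s (z - y) + (norm (u y))\<^sup>2" for y
    proof -
      have "2 * gaussian s (z - y) * norm (u y) \<le> (gaussian s (z - y))\<^sup>2 + (norm (u y))\<^sup>2"
        by (rule sum_squares_bound)
      moreover have "(gaussian s (z - y))\<^sup>2 \<le> c * gaussian s (z - y)"
        unfolding power2_eq_square by (intro mult_right_mono le) simp
      moreover have "0 \<le> gaussian s (z - y) * norm (u y)"
        by simp
      ultimately have "gaussian s (z - y) * norm (u y) \<le> c * gaussian s (z - y) + (norm (u y))\<^sup>2"
        unfolding mult.assoc by linarith
      then show ?thesis
        by simp
    qed
    then show "AE y in lebesgue. norm (gaussian s (z - y) *\<^sub>R u y) \<le> norm (c * gaussian s (z - y) + (norm (u y))\<^sup>2)"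
      by (intro AE_I2) (metis abs_ge_self order_trans real_norm_def)
  qed measurable
qed

lemma
  fixes u :: "real ^ 'n \<Rightarrow> complex"
  assumes u: "u \<in> L2_space" and \<sigma>: "\<sigma> > 0"
  shows integrable_gaussian_deriv_L2: "integrable lebesgue (\<lambda>y. gaussian_deriv \<sigma> (z - y) *\<^sub>R u y)"
    and convolution_gaussian_differentiable: "(\<lambda>s. convolution u (gaussian s) z) differentiable (at \<sigma>)"
    and texture_eq_convolution: "texture z u \<sigma> = convolution u (gaussian_deriv \<sigma>) z"
proof -
  have m: "u \<in> borel_measurable lebesgue"
    using u by (simp add: L2_space_def)
  note * = has_vector_derivative_convolution_gaussian[OF \<sigma> m integrable_gaussian_scaleR_L2[OF u], of z]
  show "integrable lebesgue (\<lambda>y. gaussian_deriv \<sigma> (z - y) *\<^sub>R u y)"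
    by (rule *)
  show "(\<lambda>s. convolution u (gaussian s) z) differentiable (at \<sigma>)"
    using *(2) by (rule differentiableI_vector)
  show "texture z u \<sigma> = convolution u (gaussian_deriv \<sigma>) z"
    unfolding texture_def using *(2) by (rule vector_derivative_at)
qed

text \<open>The hypothesis \<open>mg\<close> guarantees that the choice in
  \<open>fourier_L2 f\<close> is a genuine transform, and uniqueness identifies it a.e. with
  \<open>m * g\<close>. This suffices because the Sobolev norm sees the transform only under an
  integral.\<close>

lemma sobolev_bound_of_multiplier:
  fixes f g :: "real ^ 'n \<Rightarrow> complex"
  assumes f: "f \<in> L2_space" and mg: "has_fourier_L2 f (\<lambda>\<xi>. m \<xi> * g \<xi>)"
    and g: "g \<in> borel_measurable borel" and fin: "L2sq lborel g \<le> ennreal b" and b: "0 \<le> b"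
    and B: "\<And>\<xi>. (1 + (norm \<xi>)\<^sup>2) powr k * (norm (m \<xi>))\<^sup>2 \<le> B"
  shows "f \<in> sobolev_space k" and "sobolev_norm k f \<le> sqrt (B * b)"
proof -
  define h where "h = fourier_L2 f"
  have h: "has_fourier_L2 f h"
    unfolding h_def fourier_L2_def using mg by (rule someI[of "has_fourier_L2 f"])
  have f': "f \<in> borel_measurable lebesgue" and [measurable]: "h \<in> borel_measurable lebesgue"
    using f h by (auto simp: L2_space_def has_fourier_L2_def)
  have eq: "AE \<xi> in lebesgue. h \<xi> = m \<xi> * g \<xi>"
    using has_fourier_L2_unique[OF f' h mg] .
  have B0: "0 \<le> B"
    by (rule order_trans[OF _ B[of 0]]) simp
  have [measurable]: "(\<lambda>\<xi>. (1 + (norm \<xi>)\<^sup>2) powr k) \<in> borel_measurable (lebesgue :: (real ^ 'n) measure)"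
    by (rule measurable_completion) measurable
  let ?I = "\<lambda>\<xi>. (1 + (norm \<xi>)\<^sup>2) powr k * (norm (h \<xi>))\<^sup>2"
  have "(\<integral>\<^sup>+\<xi>. ennreal (?I \<xi>) \<partial>lebesgue) \<le> (\<integral>\<^sup>+\<xi>. ennreal B * ennreal ((norm (g \<xi>))\<^sup>2) \<partial>lebesgue)"
  proof (rule nn_integral_mono_AE)
    show "AE \<xi> in lebesgue. ennreal (?I \<xi>) \<le> ennreal B * ennreal ((norm (g \<xi>))\<^sup>2)"
      using eq
    proof eventually_elim
      case (elim \<xi>)
      have "?I \<xi> \<le> B * (norm (g \<xi>))\<^sup>2"
        using mult_right_mono[OF B[of \<xi>], of "(norm (g \<xi>))\<^sup>2"]
        by (simp add: elim norm_mult power_mult_distrib mult.assoc)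
      then show ?case
        using B0 by (simp add: ennreal_mult[symmetric] ennreal_leI)
    qed
  qed
  also have "\<dots> = ennreal B * L2sq lborel g"
    using g by (simp add: L2sq_def nn_integral_completion nn_integral_cmult)
  also have "\<dots> \<le> ennreal (B * b)"
    using mult_left_mono[OF fin, of "ennreal B"] B0 b by (simp add: ennreal_mult)
  finally have le: "(\<integral>\<^sup>+\<xi>. ennreal (?I \<xi>) \<partial>lebesgue) \<le> ennreal (B * b)" .
  have int: "integrable lebesgue ?I"
    unfolding integrable_iff_bounded
  proof
    show "(\<integral>\<^sup>+\<xi>. ennreal (norm (?I \<xi>)) \<partial>lebesgue) < \<infinity>"
      using le by (simp add: order_le_less_trans)
  qed measurable
  then show "f \<in> sobolev_space k"
    using f by (simp add: sobolev_space_def h_def)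
  have "(LINT \<xi>|lebesgue. ?I \<xi>) \<le> B * b"
    using le B0 b by (subst (asm) nn_integral_eq_integral[OF int]) auto
  then show "sobolev_norm k f \<le> sqrt (B * b)"
    by (simp add: sobolev_norm_def h_def)
qed

text \<open>The Fourier lemmas are applied to a Borel representative \<open>v\<close>, which has the
  same texture as \<open>u\<close> at every point and the same L2 norm.\<close>

lemma texture_sobolev_bound:
  assumes \<sigma>: "\<sigma> > 0" and k: "k \<ge> 0"
  obtains C where "C > 0"
    "\<And>u :: real ^ 'n \<Rightarrow> complex. u \<in> L2_space \<Longrightarrow> (\<lambda>z. texture z u \<sigma>) \<in> sobolev_space k"
    "\<And>u :: real ^ 'n \<Rightarrow> complex. u \<in> L2_space \<Longrightarrow> sobolev_norm k (\<lambda>z. texture z u \<sigma>) \<le> C * L2_norm u"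
proof -
  obtain B where B: "\<And>\<xi> :: real ^ 'n. (1 + (norm \<xi>)\<^sup>2) powr k *
     (norm (fourier_L1 (\<lambda>x. of_real (gaussian_deriv \<sigma> x)) \<xi>))\<^sup>2 \<le> B"
    using sobolev_multiplier_bound[OF \<sigma> k] by blast
  have B0: "0 \<le> B"
    by (rule order_trans[OF _ B[of 0]]) simp
  define K where "K = (2 * pi) ^ CARD('n)"
  have K: "K > 0"
    by (simp add: K_def)
  have main: "(\<lambda>z. texture z u \<sigma>) \<in> sobolev_space k \<and> sobolev_norm k (\<lambda>z. texture z u \<sigma>) \<le> sqrt (B * (K * (L2_norm u)\<^sup>2))"
    if u: "u \<in> L2_space" for u :: "real ^ 'n \<Rightarrow> complex"
  proof -
    have u': "u \<in> borel_measurable lebesgue" and fin: "L2sq lborel u < \<infinity>"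
      using u by (auto simp: L2_space_iff)
    obtain v where v: "v \<in> borel_measurable borel" "AE x in lebesgue. u x = v x"
      using lebesgue_borel_representative[OF u'] .
    have norm_v: "L2sq lborel v = L2sq lborel u"
      using L2sq_cong_AE[OF v(2)] by (simp add: L2sq_lebesgue)
    then have v_fin: "L2sq lborel v < \<infinity>"
      using fin by simp
    have v_L2: "v \<in> L2_space"
      using v v_fin by (simp add: L2_space_iff measurable_completion)
    obtain g where g: "g \<in> borel_measurable borel" "has_fourier_L2 v g" "L2sq lborel g \<le> ennreal K * L2sq lborel v"
      using fourier_L2_exists[OF v(1) v_fin] unfolding K_def .
    have tex: "(\<lambda>z. texture z u \<sigma>) = convolution v (gaussian_deriv \<sigma>)"
      unfolding texture_eq_convolution[OF u \<sigma>]
      using u' v by (intro ext convolution_cong_AE) (auto intro: measurable_completion)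
    have [measurable]: "v \<in> borel_measurable borel"
      by (rule v)
    have "integrable lborel (\<lambda>y. gaussian_deriv \<sigma> (z - y) *\<^sub>R v y)" for z
      using integrable_gaussian_deriv_L2[OF v_L2 \<sigma>] by (subst (asm) integrable_completion) auto
    note conv = has_fourier_L2_convolution[OF v(1) v_fin integrable_gaussian_deriv[OF \<sigma>] this g(1,2)]
    have "ennreal K * L2sq lborel v = ennreal (K * (L2_norm u)\<^sup>2)"
      unfolding norm_v L2sq_eq_L2_norm[OF u] using K by (simp add: ennreal_mult)
    then have "L2sq lborel g \<le> ennreal (K * (L2_norm u)\<^sup>2)"
      using g(3) by simp
    from sobolev_bound_of_multiplier[OF conv g(1) this _ B] show ?thesis
      using K unfolding tex by auto
  qed
  have L2_nonneg: "0 \<le> L2_norm u" for u :: "real ^ 'n \<Rightarrow> complex"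
    by (simp add: L2_norm_def)
  show ?thesis
  \<comment> \<open>The estimate itself gives \<open>sqrt (B * K)\<close>; as only
    \<open>0 \<le> B\<close> is known, adding 1 makes the constant positive.\<close>
  proof (rule that[of "sqrt (B * K) + 1"])
    show "0 < sqrt (B * K) + 1"
      using B0 K by (simp add: add_nonneg_pos)
    fix u :: "real ^ 'n \<Rightarrow> complex" assume u: "u \<in> L2_space"
    show "(\<lambda>z. texture z u \<sigma>) \<in> sobolev_space k"
      using main[OF u] ..
    have "sobolev_norm k (\<lambda>z. texture z u \<sigma>) \<le> sqrt (B * K) * L2_norm u"
      using main[OF u] L2_nonneg[of u] by (simp add: real_sqrt_mult mult.assoc)
    also have "\<dots> \<le> (sqrt (B * K) + 1) * L2_norm u"
      using L2_nonneg by (intro mult_right_mono) auto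
    finally show "sobolev_norm k (\<lambda>z. texture z u \<sigma>) \<le> (sqrt (B * K) + 1) * L2_norm u" .
  qed
qed

lemma L2_space_add:
  assumes "u \<in> L2_space" "v \<in> L2_space"
  shows "(\<lambda>x. u x + v x) \<in> L2_space"
proof -
  have [measurable]: "u \<in> borel_measurable lebesgue" "v \<in> borel_measurable lebesgue"
    using assms by (auto simp: L2_space_iff)
  have "L2sq lebesgue (\<lambda>x. u x + v x) \<le> 2 * L2sq lebesgue u + 2 * L2sq lebesgue v"
    by (rule L2sq_add) auto
  also have "\<dots> < \<infinity>"
    using assms by (simp add: L2_space_iff L2sq_lebesgue ennreal_mult_less_top)
  finally show ?thesis
    by (simp add: L2_space_iff L2sq_lebesgue)
qed

lemma L2_space_cmult:
  assumes "u \<in> L2_space"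
  shows "(\<lambda>x. c * u x) \<in> L2_space"
  using assms by (auto simp: L2_space_def norm_mult power_mult_distrib)

text \<open>The first conjunct rules out default values: a Bochner integral of a non-integrable
  function is 0, and \<open>vector_derivative\<close> of a non-differentiable function is arbitrary.
  With it \<open>texture\<close> is a true derivative for every \<open>u\<close> in L2, so the
  extension to L2 is given by the same formula.\<close>

theorem proposition3p6:
  fixes \<sigma> k :: real
  assumes "\<sigma> > 0" and "k \<ge> 0"
  shows "(\<forall>u \<in> (L2_space :: (real ^ 'n \<Rightarrow> complex) set). \<forall>z.
            (\<forall>s>0. integrable lebesgue (\<lambda>y. gaussian s (z - y) *\<^sub>R u y)) \<and>
            (\<lambda>s. convolution u (gaussian s) z) differentiable (at \<sigma>))
       \<and> bounded_linear_operator
            (L2_space :: (real ^ 'n \<Rightarrow> complex) set) L2_norm (sobolev_space k) (sobolev_norm k)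
            (\<lambda>u z. texture z u \<sigma>)
       \<and> (\<exists>C>0. \<forall>u \<in> (L2_space :: (real ^ 'n \<Rightarrow> complex) set).
            sobolev_norm k (\<lambda>z. texture z u \<sigma>) \<le> C * L2_norm u)"
proof -
  obtain C where C: "C > 0"
    "\<And>u :: real ^ 'n \<Rightarrow> complex. u \<in> L2_space \<Longrightarrow> (\<lambda>z. texture z u \<sigma>) \<in> sobolev_space k"
    "\<And>u :: real ^ 'n \<Rightarrow> complex. u \<in> L2_space \<Longrightarrow> sobolev_norm k (\<lambda>z. texture z u \<sigma>) \<le> C * L2_norm u"
    using texture_sobolev_bound[OF assms] by blast
  have cong: "texture z u \<sigma> = texture z v \<sigma>"
    if u: "u \<in> L2_space" and v: "v \<in> L2_space" and eq: "AE x in lebesgue. u x = v x"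
    for u v :: "real ^ 'n \<Rightarrow> complex" and z
    unfolding texture_eq_convolution[OF u assms(1)] texture_eq_convolution[OF v assms(1)]
    by (rule convolution_cong_AE) (use u v eq in \<open>auto simp: L2_space_def\<close>)
  \<comment> \<open>Derivatives are traded for convolutions with the fixed kernel
    \<open>gaussian_deriv \<sigma>\<close>, whose integrands are integrable at every
    \<open>z\<close>; linearity thus holds pointwise, not only a.e.\<close>
  have add: "texture z (\<lambda>y. u y + v y) \<sigma> = texture z u \<sigma> + texture z v \<sigma>"
    if "u \<in> L2_space" "v \<in> L2_space" for u v :: "real ^ 'n \<Rightarrow> complex" and z
    using that by (simp add: texture_eq_convolution assms(1) L2_space_add convolution_def
        scaleR_add_right integrable_gaussian_deriv_L2)
  have cmult: "texture z (\<lambda>y. c * u y) \<sigma> = c * texture z u \<sigma>"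
    if "u \<in> L2_space" for u :: "real ^ 'n \<Rightarrow> complex" and z c
  proof -
    have "(LINT y|lebesgue. gaussian_deriv \<sigma> (z - y) *\<^sub>R (c * u y))
        = (LINT y|lebesgue. c * (gaussian_deriv \<sigma> (z - y) *\<^sub>R u y))"
      by (simp add: scaleR_conv_of_real mult.left_commute)
    then show ?thesis
      using that by (simp only: texture_eq_convolution assms(1) L2_space_cmult convolution_def integral_mult_right_zero)
  qed
  have "bounded_linear_operator (L2_space :: (real ^ 'n \<Rightarrow> complex) set) L2_norm (sobolev_space k) (sobolev_norm k)
      (\<lambda>u z. texture z u \<sigma>)"
    unfolding bounded_linear_operator_def
  proof (intro conjI ballI allI impI)
    fix u v :: "real ^ 'n \<Rightarrow> complex" and c :: complex
    assume u: "u \<in> L2_space"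
    show "AE x in lebesgue. texture x (\<lambda>y. c * u y) \<sigma> = c * texture x u \<sigma>"
      by (intro AE_I2 cmult u)
    assume v: "v \<in> L2_space"
    show "AE x in lebesgue. texture x (\<lambda>y. u y + v y) \<sigma> = texture x u \<sigma> + texture x v \<sigma>"
      by (intro AE_I2 add u v)
    assume eq: "AE x in lebesgue. u x = v x"
    show "AE x in lebesgue. texture x u \<sigma> = texture x v \<sigma>"
      by (rule AE_I2, rule cong[OF u v eq])
  next
    show "\<exists>C. \<forall>u\<in>(L2_space :: (real ^ 'n \<Rightarrow> complex) set). sobolev_norm k (\<lambda>z. texture z u \<sigma>) \<le> C * L2_norm u"
      using C(3) by blast
  qed (rule C(2))
  then show ?thesis
    using C(1,3) integrable_gaussian_scaleR_L2 convolution_gaussian_differentiable[OF _ assms(1)] by blast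
qed

end
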